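(* Let $d\ge 1$, let $\Lambda(\boldsymbol{B})$ be any $d$-dimensional lattice in $\mathbb{R}^d$ and let $\Lambda(\boldsymbol{A})$ be its dual lattice scaled by $2\pi$, with Voronoi cell $\Omega(\boldsymbol{A})$, packing radius $\rho(\boldsymbol{A})$ and covering radius $R(\boldsymbol{A})$. Let $r=(\operatorname{vol}\Omega(\boldsymbol{A}))^{1/d}$ be the sampling rate. Let $\omega_0>0$, $S_0>0$, let $\Delta=\{\boldsymbol{\omega}\in\mathbb{R}^d:\|\boldsymbol{\omega}\|\le\omega_0\}$, and let $X$ be an isotropically bandlimited stationary process on $\mathbb{R}^d$, i.e. one whose power spectral density is $S(\boldsymbol{\omega})=S_0$ for $\boldsymbol{\omega}\in\Delta$ and $S(\boldsymbol{\omega})=0$ for $\boldsymbol{\omega}\notin\Delta$; let $\sigma^2$ be its variance. Let $\sigma_{\mathrm e}^2$ be the average reconstruction error variance when $X$ is sampled on $\Lambda(\boldsymbol{B})$ and reconstructed using the best linear interpolator. Then $\sigma_{\mathrm e}^2\ge\sigma_{\mathrm{lb}}^2$, where $$\sigma_{\mathrm{lb}}^2=\sigma^2\max\left\{0,\;1-\frac{\Gamma\left(\frac d2+1\right)}{\pi^{d/2}}\left(\frac{r}{\omega_0}\right)^d\right\}.$$ Further, $\sigma_{\mathrm e}^2=\sigma_{\mathrm{lb}}^2$ if and only if $\omega_0\le\rho(\boldsymbol{A})$ or $\omega_0\ge R(\boldsymbol{A})$.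
   Context: Lattices: $\Lambda(\boldsymbol{B})$ denotes the $d$-dimensional (full-rank) lattice generated over $\mathbb{Z}$ by the rows of the generator matrix $\boldsymbol{B}$. The dual lattice scaled by $2\pi$ is $\Lambda(\boldsymbol{A})=\{\boldsymbol{\lambda}\in\mathbb{R}^d:\langle\boldsymbol{\lambda},\boldsymbol{b}\rangle\in 2\pi\mathbb{Z}\text{ for all }\boldsymbol{b}\in\Lambda(\boldsymbol{B})\}$. The Voronoi cell of a lattice $\Lambda$ is $\Omega=\{\boldsymbol{x}\in\mathbb{R}^d:\|\boldsymbol{x}\|\le\|\boldsymbol{x}-\boldsymbol{\lambda}\|\text{ for all }\boldsymbol{\lambda}\in\Lambda\}$; its packing radius is $\rho=\frac12\min_{\boldsymbol{0}\ne\boldsymbol{\lambda}\in\Lambda}\|\boldsymbol{\lambda}\|$ and its covering radius is $R=\max_{\boldsymbol{x}\in\mathbb{R}^d}\min_{\boldsymbol{\lambda}\in\Lambda}\|\boldsymbol{x}-\boldsymbol{\lambda}\|$. $\Omega(\boldsymbol{A}),\rho(\boldsymbol{A}),R(\boldsymbol{A})$ are these quantities for $\Lambda(\boldsymbol{A})$, and $\Omega(\boldsymbol{B})$ is the Voronoi cell of $\Lambda(\boldsymbol{B})$. $\operatorname{vol}$ is $d$-dimensional Lebesgue measure and $\|\cdot\|$ the Euclidean norm. The sampling rate is $r=2\pi(\operatorname{vol}\Omega(\boldsymbol{B}))^{-1/d}=(\operatorname{vol}\Omega(\boldsymbol{A}))^{1/d}$. Process: $X=\{X(\boldsymbol{t})\}_{\boldsymbol{t}\in\mathbb{R}^d}$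 is a zero-mean, (wide-sense) stationary, square-integrable stochastic process with power spectral density $S$, meaning $\mathbb{E}[X(\boldsymbol{t}+\boldsymbol{s})\overline{X(\boldsymbol{t})}]=\frac{1}{(2\pi)^d}\int_{\mathbb{R}^d}S(\boldsymbol{\omega})e^{i\langle\boldsymbol{\omega},\boldsymbol{s}\rangle}\,d\boldsymbol{\omega}$. In particular its variance is $\sigma^2=\frac{1}{(2\pi)^d}\int_{\mathbb{R}^d}S(\boldsymbol{\omega})\,d\boldsymbol{\omega}=\frac{S_0}{(2\pi)^d}\operatorname{vol}\Delta$. Reconstruction: the best linear interpolator $\hat X(\boldsymbol{t})$ is the linear minimum-mean-square-error estimator of $X(\boldsymbol{t})$ from the samples $\{X(\boldsymbol{b}):\boldsymbol{b}\in\Lambda(\boldsymbol{B})\}$, i.e. the orthogonal projection in $L^2$ of $X(\boldsymbol{t})$ onto the closed linear span of the samples. The average reconstruction error variance is the average over time, which by periodicity is $$\sigma_{\mathrm e}^2=\frac{1}{\operatorname{vol}\Omega(\boldsymbol{B})}\int_{\Omega(\boldsymbol{B})}\mathbb{E}\,|X(\boldsymbol{t})-\hat X(\boldsymbol{t})|^2\,d\boldsymbol{t}.$$ *)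

theory Defs
  imports "HOL-Probability.Probability"
begin

definition lattice_of :: "real^'n^'n \<Rightarrow> (real^'n) set" where
  "lattice_of B = {x. \<exists>k :: 'n \<Rightarrow> int. x = (\<Sum>i\<in>UNIV. real_of_int (k i) *\<^sub>R row i B)}"

definition scaled_dual :: "(real^'n) set \<Rightarrow> (real^'n) set" where
  "scaled_dual L = {l. \<forall>b\<in>L. \<exists>k :: int. l \<bullet> b = 2 * pi * real_of_int k}"

definition voronoi :: "(real^'n) set \<Rightarrow> (real^'n) set" where
  "voronoi L = {x. \<forall>l\<in>L. norm x \<le> norm (x - l)}"

text \<open>For a full-rank lattice, the infima and the supremum below are attained
  (in \<^const>\<open>infdist\<close>, as the distance to a nonempty closed set), so they are the
  minima and the maximum in the usual definitions.\<close>

definition packing_radius :: "(real^'n) set \<Rightarrow> real" where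
  "packing_radius L = (INF l\<in>L - {0}. norm l) / 2"

definition covering_radius :: "(real^'n) set \<Rightarrow> real" where
  "covering_radius L = (SUP x. infdist x L)"

definition sampling_rate :: "(real^'n) set \<Rightarrow> real" where
  "sampling_rate L = measure lborel (voronoi (scaled_dual L)) powr (1 / real CARD('n))"

text \<open>Random variables are complex-valued; a real-valued process is the special case of one
  whose values have vanishing imaginary part.\<close>

definition square_integrable_rv :: "'w measure \<Rightarrow> ('w \<Rightarrow> complex) set" where
  "square_integrable_rv M = {Y \<in> borel_measurable M. integrable M (\<lambda>w. (cmod (Y w))\<^sup>2)}"

definition rv_variance :: "'w measure \<Rightarrow> ('w \<Rightarrow> complex) \<Rightarrow> real" where
  "rv_variance M Y = (\<integral>w. (cmod (Y w - (\<integral>v. Y v \<partial>M)))\<^sup>2 \<partial>M)"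

definition stationary_process_with_psd ::
  "'w measure \<Rightarrow> (real^'n \<Rightarrow> 'w \<Rightarrow> complex) \<Rightarrow> (real^'n \<Rightarrow> real) \<Rightarrow> bool" where
  "stationary_process_with_psd M X S \<longleftrightarrow>
     prob_space M \<and>
     (\<forall>t. X t \<in> square_integrable_rv M) \<and>
     (\<forall>t. (\<integral>w. X t w \<partial>M) = 0) \<and>
     (\<forall>\<omega>. 0 \<le> S \<omega>) \<and> integrable lborel S \<and>
     (\<forall>t s. (\<integral>w. X (t + s) w * cnj (X t w) \<partial>M) =
        1 / of_real ((2 * pi) ^ CARD('n)) *
        (\<integral>\<omega>. of_real (S \<omega>) * exp (\<i> * of_real (\<omega> \<bullet> s)) \<partial>lborel))"

definition isotropic_psd :: "real \<Rightarrow> real \<Rightarrow> real^'n \<Rightarrow> real" where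
  "isotropic_psd \<omega>\<^sub>0 S\<^sub>0 \<omega> = (if norm \<omega> \<le> \<omega>\<^sub>0 then S\<^sub>0 else 0)"

definition sample_span ::
  "(real^'n \<Rightarrow> 'w \<Rightarrow> complex) \<Rightarrow> (real^'n) set \<Rightarrow> ('w \<Rightarrow> complex) set" where
  "sample_span X L = {(\<lambda>w. \<Sum>b\<in>F. c b * X b w) | F c. finite F \<and> F \<subseteq> L}"

definition closed_sample_span ::
  "'w measure \<Rightarrow> (real^'n \<Rightarrow> 'w \<Rightarrow> complex) \<Rightarrow> (real^'n) set \<Rightarrow> ('w \<Rightarrow> complex) set" where
  "closed_sample_span M X L = {Y \<in> square_integrable_rv M.
     \<forall>\<epsilon>>0. \<exists>Z\<in>sample_span X L. (\<integral>w. (cmod (Y w - Z w))\<^sup>2 \<partial>M) < \<epsilon>}"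

text \<open>Elements of \<open>L\<^sup>2\<close> are represented by functions, so a best linear interpolator is
  unique only up to almost-sure equality at each \<open>t\<close>; hence a predicate rather than a function.\<close>

definition best_linear_interpolator ::
  "'w measure \<Rightarrow> (real^'n \<Rightarrow> 'w \<Rightarrow> complex) \<Rightarrow> (real^'n) set \<Rightarrow>
   (real^'n \<Rightarrow> 'w \<Rightarrow> complex) \<Rightarrow> bool" where
  "best_linear_interpolator M X L Xhat \<longleftrightarrow>
     (\<forall>t. Xhat t \<in> closed_sample_span M X L \<and>
        (\<forall>Y\<in>closed_sample_span M X L. (\<integral>w. (X t w - Xhat t w) * cnj (Y w) \<partial>M) = 0))"

definition avg_error_variance ::
  "'w measure \<Rightarrow> (real^'n \<Rightarrow> 'w \<Rightarrow> complex) \<Rightarrow> (real^'n) set \<Rightarrow>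
   (real^'n \<Rightarrow> 'w \<Rightarrow> complex) \<Rightarrow> real" where
  "avg_error_variance M X L Xhat =
     1 / measure lborel (voronoi L) *
     (LINT t:voronoi L|lborel. (\<integral>w. (cmod (X t w - Xhat t w))\<^sup>2 \<partial>M))"

end

theory Submission
  imports Defs "HOL-Complex_Analysis.Cauchy_Integral_Theorem"
begin

text \<open>
  By the spectral isometry, the error of a linear interpolator at time \<open>t\<close> is, up to the factor
  \<open>S\<^sub>0 / (2\<pi>)\<^sup>d\<close>, the squared distance in \<open>L\<^sup>2(\<Delta>)\<close> between the character
  \<open>\<omega> \<mapsto> cis (\<omega> \<bullet> t)\<close> and a trigonometric polynomial, which is periodic with respect to
  the scaled dual lattice \<open>\<Lambda>\<close>. The best periodic approximation \<open>g\<^sub>t(\<omega>)\<close> is the mean of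
  the character over the \<open>N(\<omega>)\<close> points of \<open>\<omega> + \<Lambda>\<close> in \<open>\<Delta>\<close>, and trigonometric
  polynomials are dense among the periodic functions, so the optimal error is
  \<open>vol \<Delta> - \<integral>\<^sub>\<Delta> |g\<^sub>t|\<^sup>2\<close>. Averaging over \<open>t\<close> annihilates the cross terms and turns
  \<open>|g\<^sub>t|\<^sup>2\<close> into \<open>1 / N\<close>, whose integral over \<open>\<Delta>\<close> is \<open>vol (\<Delta> \<inter> \<Omega>)\<close> for
  the Voronoi cell \<open>\<Omega>\<close> of \<open>\<Lambda>\<close>: almost every orbit meets \<open>\<Omega>\<close> exactly once, in its
  point of least norm. Thus the average error is proportional to \<open>vol \<Delta> - vol (\<Delta> \<inter> \<Omega>)\<close>,
  and the bound together with its equality cases (\<open>\<Delta> \<subseteq> \<Omega>\<close> or \<open>\<Omega> \<subseteq> \<Delta>\<close>) follows.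
\<close>

section \<open>Polynomial approximation in mean square\<close>

text \<open>The intended instance is the image of Lebesgue measure on a ball under
  \<open>torus_map\<close>. The compact set \<open>T\<close> carrying all the mass is where
  Stone-Weierstrass gets applied.\<close>

locale compactly_supported_measure = finite_measure \<nu> for \<nu> :: "'a::euclidean_space measure" +
  fixes T :: "'a set"
  assumes sets_eq_borel [measurable_cong]: "sets \<nu> = sets borel"
    and compact_support: "compact T"
    and AE_support: "AE x in \<nu>. x \<in> T"
begin

text \<open>Boundedness is asked for on \<open>T\<close> alone, so that polynomials qualify although
  they are unbounded on the whole space. Since \<open>T\<close> has full measure, this still yields
  integrability.\<close>

definition admissible :: "('a \<Rightarrow> real) \<Rightarrow> bool" where
  "admissible f \<longleftrightarrow> f \<in> borel_measurable borel \<and> (\<exists>M. \<forall>x\<in>T. \<bar>f x\<bar> \<le> M)"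

text \<open>Membership in the mean-square closure of the real polynomials. The following lemmas
  enlarge the class in turn to continuous functions, Borel indicators and bounded Borel
  functions.\<close>

definition approximable :: "('a \<Rightarrow> real) \<Rightarrow> bool" where
  "approximable f \<longleftrightarrow> admissible f \<and>
     (\<forall>\<epsilon>>0. \<exists>p. real_polynomial_function p \<and> (\<integral>x. (f x - p x)\<^sup>2 \<partial>\<nu>) < \<epsilon>)"

lemma admissible_add: "admissible f \<Longrightarrow> admissible g \<Longrightarrow> admissible (\<lambda>x. f x + g x)"
  unfolding admissible_def
  by (auto intro!: borel_measurable_add) (meson abs_triangle_ineq add_mono order_trans)

lemma admissible_mult: "admissible f \<Longrightarrow> admissible g \<Longrightarrow> admissible (\<lambda>x. f x * g x)"
  unfolding admissible_def
  by (auto intro!: borel_measurable_times simp: abs_mult) (meson abs_ge_zero mult_mono order_trans)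

lemma admissible_const: "admissible (\<lambda>x. c)"
  unfolding admissible_def by auto

lemma admissible_diff: "admissible f \<Longrightarrow> admissible g \<Longrightarrow> admissible (\<lambda>x. f x - g x)"
  using admissible_add[OF _ admissible_mult[OF admissible_const[of "-1"]]] by fastforce

lemma admissible_power2: "admissible f \<Longrightarrow> admissible (\<lambda>x. (f x)\<^sup>2)"
  using admissible_mult by (simp add: power2_eq_square)

lemma admissible_integrable:
  assumes "admissible f" shows "integrable \<nu> f"
proof -
  obtain M where M: "\<And>x. x \<in> T \<Longrightarrow> \<bar>f x\<bar> \<le> M" and [measurable]: "f \<in> borel_measurable borel"
    using assms unfolding admissible_def by auto
  show ?thesis
    by (rule integrable_const_bound[where B = M])
       (use AE_support M in \<open>auto elim!: eventually_mono\<close>)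
qed

lemma admissible_continuous: "continuous_on UNIV f \<Longrightarrow> admissible f"
proof -
  assume f: "continuous_on UNIV f"
  then have "bounded (f ` T)"
    using compact_support by (meson compact_continuous_image compact_imp_bounded continuous_on_subset top_greatest)
  then show ?thesis
    using f unfolding admissible_def bounded_iff by (auto intro: borel_measurable_continuous_onI)
qed

lemma admissible_poly: "real_polynomial_function p \<Longrightarrow> admissible p"
  by (intro admissible_continuous) (simp add: continuous_at_imp_continuous_on continuous_real_polymonial_function)

text \<open>A substitute for the triangle inequality of the mean-square norm that avoids square
  roots. Its factors 2 are the reason for the quarters of \<open>\<epsilon>\<close> below.\<close>

lemma integral_square_triangle:
  assumes "admissible f" "admissible g" "admissible h"
  shows "(\<integral>x. (f x - h x)\<^sup>2 \<partial>\<nu>) \<le> 2 * (\<integral>x. (f x - g x)\<^sup>2 \<partial>\<nu>) + 2 * (\<integral>x. (g x - h x)\<^sup>2 \<partial>\<nu>)"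
proof -
  have i: "integrable \<nu> (\<lambda>x. (u x - v x)\<^sup>2)" if "admissible u" "admissible v" for u v
    using that by (intro admissible_integrable admissible_power2 admissible_diff)
  have "(\<integral>x. (f x - h x)\<^sup>2 \<partial>\<nu>) \<le> (\<integral>x. 2 * (f x - g x)\<^sup>2 + 2 * (g x - h x)\<^sup>2 \<partial>\<nu>)"
  proof (rule integral_mono)
    fix x
    \<comment> \<open>With u = f - g and v = g - h, the parallelogram identity (u + v)^2 + (u - v)^2
      = 2 u^2 + 2 v^2 leaves the nonnegative square (u - v)^2 to be dropped.\<close>
    have "0 \<le> (f x - g x - (g x - h x))\<^sup>2" by simp
    then show "(f x - h x)\<^sup>2 \<le> 2 * (f x - g x)\<^sup>2 + 2 * (g x - h x)\<^sup>2"
      by (simp add: power2_eq_square algebra_simps)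
  qed (use assms i in auto)
  then show ?thesis using assms i by simp
qed

lemma approximable_limit:
  assumes "admissible f" "\<And>\<epsilon>. \<epsilon> > 0 \<Longrightarrow> \<exists>g. approximable g \<and> (\<integral>x. (f x - g x)\<^sup>2 \<partial>\<nu>) < \<epsilon>"
  shows "approximable f"
  unfolding approximable_def
proof (intro conjI allI impI)
  fix \<epsilon> :: real assume "\<epsilon> > 0"
  then obtain g where g: "approximable g" "(\<integral>x. (f x - g x)\<^sup>2 \<partial>\<nu>) < \<epsilon>/4"
    using assms(2)[of "\<epsilon>/4"] by auto
  then obtain p where p: "real_polynomial_function p" "(\<integral>x. (g x - p x)\<^sup>2 \<partial>\<nu>) < \<epsilon>/4"
    using \<open>\<epsilon> > 0\<close> unfolding approximable_def by (meson divide_pos_pos zero_less_numeral)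
  have "(\<integral>x. (f x - p x)\<^sup>2 \<partial>\<nu>) \<le> 2 * (\<integral>x. (f x - g x)\<^sup>2 \<partial>\<nu>) + 2 * (\<integral>x. (g x - p x)\<^sup>2 \<partial>\<nu>)"
    using assms(1) g(1) p(1) by (intro integral_square_triangle) (auto simp: approximable_def admissible_poly)
  then show "\<exists>p. real_polynomial_function p \<and> (\<integral>x. (f x - p x)\<^sup>2 \<partial>\<nu>) < \<epsilon>"
    using g(2) p by (intro exI[of _ p]) auto
qed (use assms in auto)

lemma approximable_add:
  assumes "approximable f" "approximable g"
  shows "approximable (\<lambda>x. f x + g x)"
  unfolding approximable_def
proof (intro conjI allI impI)
  fix \<epsilon> :: real assume e: "\<epsilon> > 0"
  obtain p where p: "real_polynomial_function p" "(\<integral>x. (f x - p x)\<^sup>2 \<partial>\<nu>) < \<epsilon>/4"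
    using e assms(1) unfolding approximable_def by (meson divide_pos_pos zero_less_numeral)
  obtain q where q: "real_polynomial_function q" "(\<integral>x. (g x - q x)\<^sup>2 \<partial>\<nu>) < \<epsilon>/4"
    using e assms(2) unfolding approximable_def by (meson divide_pos_pos zero_less_numeral)
  have adm: "admissible f" "admissible g" "admissible p" "admissible q"
    using assms p q by (auto simp: approximable_def admissible_poly)
  have "(\<integral>x. ((f x + g x) - (p x + q x))\<^sup>2 \<partial>\<nu>)
      \<le> 2 * (\<integral>x. ((f x + g x) - (p x + g x))\<^sup>2 \<partial>\<nu>) + 2 * (\<integral>x. ((p x + g x) - (p x + q x))\<^sup>2 \<partial>\<nu>)"
    by (intro integral_square_triangle admissible_add adm)
  then have "(\<integral>x. ((f x + g x) - (p x + q x))\<^sup>2 \<partial>\<nu>) < \<epsilon>"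
    using p q by simp
  then show "\<exists>p. real_polynomial_function p \<and> (\<integral>x. (f x + g x - p x)\<^sup>2 \<partial>\<nu>) < \<epsilon>"
    using p q by (intro exI[of _ "\<lambda>x. p x + q x"]) (auto intro: real_polynomial_function.intros(3))
qed (use assms in \<open>auto simp: approximable_def admissible_add\<close>)

lemma approximable_cmul:
  assumes "approximable f"
  shows "approximable (\<lambda>x. c * f x)"
  unfolding approximable_def
proof (intro conjI allI impI)
  fix \<epsilon> :: real assume e: "\<epsilon> > 0"
  \<comment> \<open>Adding 1 to the square of \<open>c\<close> keeps the denominator positive when
    \<open>c\<close> is 0.\<close>
  have "\<epsilon> / (c\<^sup>2 + 1) > 0" using e by (intro divide_pos_pos add_nonneg_pos) auto
  then obtain p where p: "real_polynomial_function p" "(\<integral>x. (f x - p x)\<^sup>2 \<partial>\<nu>) < \<epsilon> / (c\<^sup>2 + 1)"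
    using assms(1) unfolding approximable_def by meson
  have "(\<integral>x. (c * f x - c * p x)\<^sup>2 \<partial>\<nu>) = c\<^sup>2 * (\<integral>x. (f x - p x)\<^sup>2 \<partial>\<nu>)"
    by (simp add: right_diff_distrib[symmetric] power_mult_distrib)
  also have "\<dots> \<le> (c\<^sup>2 + 1) * (\<integral>x. (f x - p x)\<^sup>2 \<partial>\<nu>)"
    by (intro mult_right_mono integral_nonneg_AE) auto
  also have "\<dots> < \<epsilon>"
    using p(2) by (simp add: add_nonneg_pos pos_less_divide_eq mult.commute)
  finally show "\<exists>p. real_polynomial_function p \<and> (\<integral>x. (c * f x - p x)\<^sup>2 \<partial>\<nu>) < \<epsilon>"
    using p by (intro exI[of _ "\<lambda>x. c * p x"]) (auto intro: real_polynomial_function.intros)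
qed (use assms in \<open>auto simp: approximable_def admissible_mult admissible_const\<close>)

lemma uniform_imp_integral_square_le:
  assumes "\<And>x. x \<in> T \<Longrightarrow> \<bar>f x - g x\<bar> \<le> \<delta>" "admissible f" "admissible g"
  shows "(\<integral>x. (f x - g x)\<^sup>2 \<partial>\<nu>) \<le> \<delta>\<^sup>2 * measure \<nu> UNIV"
proof -
  have "(\<integral>x. (f x - g x)\<^sup>2 \<partial>\<nu>) \<le> (\<integral>x. \<delta>\<^sup>2 \<partial>\<nu>)"
  proof (rule integral_mono_AE)
    show "AE x in \<nu>. (f x - g x)\<^sup>2 \<le> \<delta>\<^sup>2"
      using AE_support
    proof eventually_elim
      case (elim x)
      show ?case
        using power_mono[OF assms(1)[OF elim], of 2] by simp
    qed
  qed (use assms in \<open>auto intro!: admissible_integrable admissible_power2 admissible_diff\<close>)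
  then show ?thesis using sets_eq_imp_space_eq[OF sets_eq_borel] by (simp add: mult.commute)
qed

lemma uniform_limit_approximable:
  assumes "admissible f"
    and "\<And>\<delta>. \<delta> > 0 \<Longrightarrow> \<exists>g. approximable g \<and> (\<forall>x\<in>T. \<bar>f x - g x\<bar> \<le> \<delta>)"
  shows "approximable f"
proof (rule approximable_limit)
  fix \<epsilon> :: real assume e: "\<epsilon> > 0"
  define m where "m = measure \<nu> UNIV"
  have m: "m \<ge> 0" unfolding m_def by simp
  \<comment> \<open>The uniform error \<open>\<delta>\<close> costs at most \<epsilon> m / (m + 1)
    in mean square, which is below \<epsilon>; the summand 1 also covers the zero measure.\<close>
  define \<delta> where "\<delta> = sqrt (\<epsilon> / (m + 1))"
  have d: "\<delta> > 0" "\<delta>\<^sup>2 = \<epsilon> / (m + 1)" using e m by (auto simp: \<delta>_def)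
  obtain g where g: "approximable g" "\<forall>x\<in>T. \<bar>f x - g x\<bar> \<le> \<delta>"
    using assms(2)[OF d(1)] by auto
  have "(\<integral>x. (f x - g x)\<^sup>2 \<partial>\<nu>) \<le> \<delta>\<^sup>2 * m"
    unfolding m_def using g assms by (intro uniform_imp_integral_square_le) (auto simp: approximable_def)
  also have "\<dots> < \<epsilon>"
    using e m by (simp add: d(2) pos_divide_less_eq)
  finally show "\<exists>g. approximable g \<and> (\<integral>x. (f x - g x)\<^sup>2 \<partial>\<nu>) < \<epsilon>" using g by auto
qed fact

lemma approximable_poly:
  assumes "real_polynomial_function p" shows "approximable p"
  unfolding approximable_def using assms by (auto simp: admissible_poly intro!: exI[of _ p])

lemma approximable_continuous:
  assumes "continuous_on UNIV f" shows "approximable f"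
proof (rule uniform_limit_approximable)
  fix \<delta> :: real assume "\<delta> > 0"
  then obtain g where "real_polynomial_function g" "\<And>x. x \<in> T \<Longrightarrow> \<bar>f x - g x\<bar> < \<delta>"
    using Stone_Weierstrass_real_polynomial_function
      [OF compact_support continuous_on_subset[OF assms subset_UNIV] \<open>\<delta> > 0\<close>] by blast
  then show "\<exists>g. approximable g \<and> (\<forall>x\<in>T. \<bar>f x - g x\<bar> \<le> \<delta>)"
    using approximable_poly by (meson less_imp_le)
qed (rule admissible_continuous[OF assms])

lemma admissible_indicator: "C \<in> sets borel \<Longrightarrow> admissible (indicator C)"
  unfolding admissible_def by (auto intro!: exI[of _ 1] split: split_indicator)

text \<open>Inner regularity of finite Borel measures, in the form of a compact subset with a small
  remainder.\<close>

lemma compact_inner_approx: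
  assumes "C \<in> sets borel" "\<epsilon> > 0"
  obtains K where "compact K" "K \<subseteq> C" "measure \<nu> (C - K) < \<epsilon>"
proof -
  have "emeasure \<nu> C = (SUP K \<in> {K. K \<subseteq> C \<and> compact K}. emeasure \<nu> K)"
    using inner_regular[OF sets_eq_borel _ assms(1)] emeasure_finite by auto
  have "\<exists>K. K \<subseteq> C \<and> compact K \<and> measure \<nu> C < measure \<nu> K + \<epsilon>"
  proof (rule ccontr)
    assume "\<not> ?thesis"
    then have a: "\<And>K. K \<subseteq> C \<Longrightarrow> compact K \<Longrightarrow> measure \<nu> K \<le> measure \<nu> C - \<epsilon>" by force
    \<comment> \<open>The empty set is one of the compact subsets, so the bound is nonnegative. This
      matters because \<open>ennreal\<close> sends negative reals to 0.\<close>
    have "0 \<le> measure \<nu> C - \<epsilon>" using a[of "{}"] by simp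
    have "emeasure \<nu> C \<le> ennreal (measure \<nu> C - \<epsilon>)"
      unfolding \<open>emeasure \<nu> C = _\<close> by (rule SUP_least) (auto simp: emeasure_eq_measure a ennreal_leI)
    then show False using assms(2) \<open>0 \<le> measure \<nu> C - \<epsilon>\<close>
      by (simp add: emeasure_eq_measure)
  qed
  then obtain K where K: "K \<subseteq> C" "compact K" "measure \<nu> C < measure \<nu> K + \<epsilon>" by auto
  have "measure \<nu> (C - K) = measure \<nu> C - measure \<nu> K"
    using K assms by (intro finite_measure_Diff) (auto simp: sets_eq_borel compact_imp_closed)
  then show ?thesis using K that by auto
qed

text \<open>Compact sets \<open>K\<close> inside \<open>C\<close> and \<open>K'\<close> inside its
  complement exhaust the measure up to \<epsilon>. A Urysohn function equal to 1 on \<open>K\<close>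
  and 0 on \<open>K'\<close> differs from the indicator on the two remainders only, and by at most
  1.\<close>

lemma approximable_indicator:
  assumes C: "C \<in> sets borel" shows "approximable (indicator C)"
proof (rule approximable_limit)
  fix \<epsilon> :: real assume e: "\<epsilon> > 0"
  obtain K where K: "compact K" "K \<subseteq> C" "measure \<nu> (C - K) < \<epsilon>/2"
    using compact_inner_approx[OF C, of "\<epsilon>/2"] e by auto
  obtain K' where K': "compact K'" "K' \<subseteq> - C" "measure \<nu> (- C - K') < \<epsilon>/2"
    using compact_inner_approx[of "- C" "\<epsilon>/2"] e C by auto
  obtain f where f: "continuous_on UNIV f" "\<And>x. f x \<in> closed_segment 1 (0::real)"
      "\<And>x. x \<in> K \<Longrightarrow> f x = 1" "\<And>x. x \<in> K' \<Longrightarrow> f x = 0"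
    using Urysohn[of K K' 1 "0::real"] K K' by (auto simp: compact_imp_closed)
  have f01: "0 \<le> f x" "f x \<le> 1" for x
    using f(2)[of x] by (auto simp: closed_segment_eq_real_ivl)
  have mK [measurable]: "C - K \<in> sets borel" "- C - K' \<in> sets borel"
    using C K K' by (auto simp: compact_imp_closed)
  have "(\<integral>x. (indicator C x - f x)\<^sup>2 \<partial>\<nu>) \<le> (\<integral>x. indicator (C - K) x + indicator (- C - K') x \<partial>\<nu>)"
  proof (rule integral_mono)
    fix x
    have "\<bar>1 - f x\<bar> \<le> 1" "\<bar>f x\<bar> \<le> 1" using f01[of x] by auto
    then have "(1 - f x)\<^sup>2 \<le> 1" "(f x)\<^sup>2 \<le> 1" by (simp_all add: abs_square_le_1)
    then show "(indicator C x - f x)\<^sup>2 \<le> indicator (C - K) x + (indicator (- C - K') x :: real)"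
      using f(3,4)[of x] by (auto simp: indicator_def)
  qed (intro admissible_integrable admissible_power2 admissible_diff admissible_add
      admissible_indicator admissible_continuous[OF f(1)] mK C)+
  also have "\<dots> = measure \<nu> (C - K) + measure \<nu> (- C - K')"
    using admissible_integrable[OF admissible_indicator] mK
    by (subst Bochner_Integration.integral_add) (auto simp: sets_eq_borel)
  also have "\<dots> < \<epsilon>" using K K' by simp
  finally show "\<exists>g. approximable g \<and> (\<integral>x. (indicator C x - g x)\<^sup>2 \<partial>\<nu>) < \<epsilon>"
    using approximable_continuous[OF f(1)] by auto
qed (rule admissible_indicator[OF C])

lemma approximable_sum:
  "finite I \<Longrightarrow> (\<And>i. i \<in> I \<Longrightarrow> approximable (f i)) \<Longrightarrow> approximable (\<lambda>x. \<Sum>i\<in>I. f i x)"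
  by (induction I rule: finite_induct)
     (auto intro: approximable_add approximable_poly[OF real_polynomial_function.intros(2)])

text \<open>Rounding the values of \<open>h\<close> down to multiples of \<delta> gives a function
  with finitely many values, hence a finite combination of indicators, that is uniformly within
  \<delta> of \<open>h\<close>.\<close>

lemma approximable_bounded_borel:
  assumes h [measurable]: "h \<in> borel_measurable borel" and M: "\<And>x. \<bar>h x\<bar> \<le> M"
  shows "approximable h"
proof (rule uniform_limit_approximable)
  show "admissible h" using h M unfolding admissible_def by auto
next
  fix \<delta> :: real assume d: "\<delta> > 0"
  define I where "I = {\<lfloor>-M/\<delta>\<rfloor>..\<lfloor>M/\<delta>\<rfloor>}"
  define C where "C k = {x. \<lfloor>h x / \<delta>\<rfloor> = k}" for k :: int
  have C: "C k \<in> sets borel" for k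
  proof -
    have "{x \<in> space borel. \<lfloor>h x / \<delta>\<rfloor> = k} \<in> sets borel" by measurable
    then show ?thesis by (simp add: C_def)
  qed
  define g where "g x = (\<Sum>k\<in>I. (of_int k * \<delta>) * indicator (C k) x)" for x
  have "approximable g"
    unfolding g_def by (intro approximable_sum approximable_cmul approximable_indicator C) (simp add: I_def)
  moreover have "\<bar>h x - g x\<bar> \<le> \<delta>" for x
  proof -
    have "-M \<le> h x" "h x \<le> M" using M[of x] by auto
    then have "-M/\<delta> \<le> h x / \<delta>" "h x / \<delta> \<le> M/\<delta>"
      using d by (intro divide_right_mono; simp)+
    then have "\<lfloor>h x / \<delta>\<rfloor> \<in> I"
      unfolding I_def atLeastAtMost_iff by (intro conjI floor_mono)
    then have "g x = of_int \<lfloor>h x / \<delta>\<rfloor> * \<delta>"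
      unfolding g_def by (subst sum.remove[of _ "\<lfloor>h x / \<delta>\<rfloor>"]) (auto simp: I_def C_def indicator_def intro!: sum.neutral)
    moreover have "of_int \<lfloor>h x / \<delta>\<rfloor> * \<delta> \<le> h x"
      using d by (subst pos_le_divide_eq[symmetric]) auto
    moreover have "h x < (of_int \<lfloor>h x / \<delta>\<rfloor> + 1) * \<delta>"
      using d by (subst pos_divide_less_eq[symmetric]) linarith+
    ultimately show ?thesis using d by (simp add: algebra_simps abs_le_iff)
  qed
  ultimately show "\<exists>g. approximable g \<and> (\<forall>x\<in>T. \<bar>h x - g x\<bar> \<le> \<delta>)" by auto
qed

end

section \<open>Point lattices and their Voronoi cells\<close>

text \<open>A discrete cocompact subgroup, described without a basis, so that the Voronoi geometry
  applies alike to the sampling lattice and to its scaled dual.\<close>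

locale point_lattice =
  fixes \<Lambda> :: "(real^'n) set"
  assumes zero_mem: "0 \<in> \<Lambda>"
    and diff_mem: "x \<in> \<Lambda> \<Longrightarrow> y \<in> \<Lambda> \<Longrightarrow> x - y \<in> \<Lambda>"
    and finite_Int_cball: "finite (\<Lambda> \<inter> cball 0 r)"
    and cocompact: "\<exists>R. \<forall>x. \<exists>l\<in>\<Lambda>. norm (x - l) \<le> R"
begin

lemma uminus_mem: "x \<in> \<Lambda> \<Longrightarrow> - x \<in> \<Lambda>"
  using diff_mem[OF zero_mem, of x] by simp

lemma add_mem: "x \<in> \<Lambda> \<Longrightarrow> y \<in> \<Lambda> \<Longrightarrow> x + y \<in> \<Lambda>"
  using diff_mem[OF _ uminus_mem, of x y] by simp

lemma countable_lattice: "countable \<Lambda>"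
proof -
  have "\<Lambda> = (\<Union>n::nat. \<Lambda> \<inter> cball 0 (real n))"
  proof (intro equalityI subsetI)
    fix x assume "x \<in> \<Lambda>"
    then show "x \<in> (\<Union>n::nat. \<Lambda> \<inter> cball 0 (real n))"
      using real_arch_simple[of "norm x"] by auto
  qed auto
  moreover have "countable (\<Union>n::nat. \<Lambda> \<inter> cball 0 (real n))"
    by (rule countable_UN) (simp_all add: countable_finite finite_Int_cball)
  ultimately show ?thesis by metis
qed

lemma separated: obtains \<epsilon> where "\<epsilon> > 0" "\<And>l. l \<in> \<Lambda> \<Longrightarrow> l \<noteq> 0 \<Longrightarrow> norm l \<ge> \<epsilon>"
proof -
  have "0 \<notin> \<Lambda> \<inter> cball 0 1 - {0}" and "finite (\<Lambda> \<inter> cball 0 1 - {0})"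
    using finite_Int_cball by auto
  then obtain d where d: "d > 0" "\<And>x. x \<in> \<Lambda> \<inter> cball 0 1 - {0} \<Longrightarrow> d \<le> dist 0 x"
    using finite_set_avoid[of "\<Lambda> \<inter> cball 0 1 - {0}" 0] by auto
  show ?thesis
  proof (rule that[of "min d 1"])
    fix l assume "l \<in> \<Lambda>" "l \<noteq> 0"
    then show "min d 1 \<le> norm l" using d(2)[of l] by (cases "norm l \<le> 1") auto
  qed (use d in auto)
qed

lemma closed_lattice: "closed \<Lambda>"
proof -
  obtain \<epsilon> where e: "\<epsilon> > 0" "\<And>l. l \<in> \<Lambda> \<Longrightarrow> l \<noteq> 0 \<Longrightarrow> norm l \<ge> \<epsilon>"
    using separated by auto
  show ?thesis
  proof (rule discrete_imp_closed[OF e(1)], intro ballI impI)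
    fix x y assume "x \<in> \<Lambda>" "y \<in> \<Lambda>" "dist y x < \<epsilon>"
    then show "y = x" using e(2)[of "y - x"] diff_mem[of y x] by (force simp: dist_norm)
  qed
qed

lemma nonzero_mem: "\<Lambda> - {0} \<noteq> {}"
proof -
  obtain R where R: "\<And>x. \<exists>l\<in>\<Lambda>. norm (x - l) \<le> R" using cocompact by auto
  obtain x :: "real^'n" where x: "norm x = \<bar>R\<bar> + 1" using vector_choose_size[of "\<bar>R\<bar> + 1"] by auto
  obtain l where "l \<in> \<Lambda>" "norm (x - l) \<le> R" using R by auto
  with x show ?thesis by (cases "l = 0") auto
qed

text \<open>Squaring the norm comparison cancels the quadratic term in x. Each lattice vector thus
  contributes a closed half-space, which makes closedness and convexity of the cell
  immediate.\<close>

lemma voronoi_eq_INT: "voronoi \<Lambda> = (\<Inter>l\<in>\<Lambda>. {x. (2 *\<^sub>R l) \<bullet> x \<le> l \<bullet> l})"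
  unfolding voronoi_def norm_le
  by (auto simp: inner_diff_left inner_diff_right inner_commute)

lemma closed_voronoi: "closed (voronoi \<Lambda>)"
  unfolding voronoi_eq_INT by (intro closed_INT ballI closed_halfspace_le)

lemma borel_voronoi [measurable]: "voronoi \<Lambda> \<in> sets borel"
  using closed_voronoi by (rule borel_closed)

lemma convex_voronoi: "convex (voronoi \<Lambda>)"
  unfolding voronoi_eq_INT by (intro convex_INT convex_halfspace_le)

lemma ball_subset_voronoi: obtains \<epsilon> where "\<epsilon> > 0" "ball 0 \<epsilon> \<subseteq> voronoi \<Lambda>"
proof -
  obtain \<epsilon> where e: "\<epsilon> > 0" "\<And>l. l \<in> \<Lambda> \<Longrightarrow> l \<noteq> 0 \<Longrightarrow> norm l \<ge> \<epsilon>"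
    using separated by auto
  have "norm x \<le> norm (x - l)" if "norm x < \<epsilon>/2" "l \<in> \<Lambda>" for x l
  proof (cases "l = 0")
    case False
    then have "norm l \<ge> \<epsilon>" using e that by auto
    moreover have "norm l \<le> norm x + norm (x - l)"
      by (metis add.commute diff_add_cancel norm_minus_commute norm_triangle_ineq)
    ultimately show ?thesis using that(1) by linarith
  qed simp
  then show ?thesis using e by (intro that[of "\<epsilon>/2"]) (auto simp: voronoi_def)
qed

lemma bounded_voronoi: obtains R where "R > 0" "voronoi \<Lambda> \<subseteq> cball 0 R"
proof -
  obtain R where R: "\<And>x. \<exists>l\<in>\<Lambda>. norm (x - l) \<le> R" using cocompact by auto
  have "norm x \<le> max R 1" if "x \<in> voronoi \<Lambda>" for x
    using R[of x] that by (fastforce simp: voronoi_def)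
  then show ?thesis by (intro that[of "max R 1"]) auto
qed

lemma lmeasurable_voronoi: "voronoi \<Lambda> \<in> fmeasurable lborel"
  using bounded_voronoi bounded_subset[OF bounded_cball] borel_voronoi
  by (metis emeasure_bounded_finite fmeasurableI sets_lborel)

lemma measure_voronoi_pos: "measure lborel (voronoi \<Lambda>) > 0"
proof -
  obtain \<epsilon> where e: "\<epsilon> > 0" "ball 0 \<epsilon> \<subseteq> voronoi \<Lambda>" using ball_subset_voronoi by auto
  have "0 < measure lborel (ball (0::real^'n) \<epsilon>)"
    using e by (simp add: content_ball_pos)
  also have "\<dots> \<le> measure lborel (voronoi \<Lambda>)"
    using e lmeasurable_voronoi by (intro measure_mono_fmeasurable) auto
  finally show ?thesis .
qed

text \<open>A closed set attains its distance to x; translating by minus a closest lattice point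
  moves x into the cell.\<close>

lemma nearest: obtains l where "l \<in> \<Lambda>" "x + l \<in> voronoi \<Lambda>"
proof -
  obtain l where l: "l \<in> \<Lambda>" "infdist x \<Lambda> = dist x l"
    using infdist_attains_inf[OF closed_lattice, of x] zero_mem by auto
  have "norm (x - l) \<le> norm (x - l - m)" if "m \<in> \<Lambda>" for m
    using infdist_le[OF add_mem[OF l(1) that], of x] l(2) by (simp add: dist_norm diff_diff_eq)
  then show ?thesis using l that[of "- l"] uminus_mem by (auto simp: voronoi_def)
qed

lemma infdist_voronoi: "x \<in> voronoi \<Lambda> \<Longrightarrow> infdist x \<Lambda> = norm x"
proof (rule antisym)
  show "infdist x \<Lambda> \<le> norm x" using infdist_le[OF zero_mem, of x] by simp
  assume x: "x \<in> voronoi \<Lambda>"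
  show "norm x \<le> infdist x \<Lambda>"
    unfolding infdist_def using x zero_mem
    by (auto simp: voronoi_def dist_norm intro!: cINF_greatest)
qed

text \<open>Two points of one orbit that both lie in the cell have equal norm. This confines x to a
  hyperplane determined by l and m, and countably many hyperplanes form a null set.\<close>

lemma AE_voronoi_unique:
  "AE x in lborel. \<forall>l\<in>\<Lambda>. \<forall>m\<in>\<Lambda>. x + l \<in> voronoi \<Lambda> \<and> x + m \<in> voronoi \<Lambda> \<longrightarrow> l = m"
proof -
  have "AE x in lborel. x + l \<in> voronoi \<Lambda> \<and> x + m \<in> voronoi \<Lambda> \<longrightarrow> l = m"
    if "l \<in> \<Lambda>" "m \<in> \<Lambda>" for l m
  proof (cases "l = m")
    case False
    have "negligible {x. (2 *\<^sub>R (l - m)) \<bullet> x = m \<bullet> m - l \<bullet> l}"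
      using False by (intro negligible_hyperplane) auto
    then have "{x. (2 *\<^sub>R (l - m)) \<bullet> x = m \<bullet> m - l \<bullet> l} \<in> null_sets lborel"
      by (simp add: negligible_iff_null_sets null_sets_completion_iff closed_hyperplane)
    moreover have "(2 *\<^sub>R (l - m)) \<bullet> x = m \<bullet> m - l \<bullet> l"
      if "x + l \<in> voronoi \<Lambda>" "x + m \<in> voronoi \<Lambda>" for x
    proof -
      have "norm (x + l) \<le> norm (x + l - (l - m))" "norm (x + m) \<le> norm (x + m - (m - l))"
        using that \<open>l \<in> \<Lambda>\<close> \<open>m \<in> \<Lambda>\<close> diff_mem unfolding voronoi_def by blast+
      then have "norm (x + l) = norm (x + m)" by simp
      then show ?thesis
        unfolding norm_eq by (simp add: inner_add_left inner_add_right inner_diff_left inner_diff_right inner_commute)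
    qed
    ultimately show ?thesis by (intro AE_I'[of "{x. (2 *\<^sub>R (l - m)) \<bullet> x = m \<bullet> m - l \<bullet> l}"]) auto
  qed simp
  then show ?thesis
    using countable_lattice by (simp add: AE_ball_countable)
qed

text \<open>On the cell the distance to the lattice is the norm, and every point can be moved into
  the cell by a lattice translation. Hence the covering radius is the least radius of a centred ball
  containing the cell.\<close>

lemma voronoi_subset_cball_iff: "voronoi \<Lambda> \<subseteq> cball 0 w \<longleftrightarrow> covering_radius \<Lambda> \<le> w"
proof
  assume sub: "voronoi \<Lambda> \<subseteq> cball 0 w"
  have "infdist x \<Lambda> \<le> w" for x
  proof -
    obtain l where l: "l \<in> \<Lambda>" "x + l \<in> voronoi \<Lambda>" using nearest by auto
    then have "infdist x \<Lambda> \<le> norm (x + l)"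
      using infdist_le[OF uminus_mem, of l x] by (simp add: dist_norm)
    then show ?thesis using l sub by force
  qed
  then show "covering_radius \<Lambda> \<le> w"
    unfolding covering_radius_def by (intro cSUP_least) auto
next
  assume w: "covering_radius \<Lambda> \<le> w"
  obtain R where R: "\<And>x. \<exists>l\<in>\<Lambda>. norm (x - l) \<le> R" using cocompact by auto
  \<comment> \<open>Cocompactness bounds the distances, so the supremum defining
    \<open>covering_radius\<close> really is an upper bound.\<close>
  have bd: "bdd_above (range (\<lambda>x. infdist x \<Lambda>))"
  proof (rule bdd_aboveI2)
    fix x show "infdist x \<Lambda> \<le> R" using R[of x] infdist_le2[of _ \<Lambda> x R] by (auto simp: dist_norm)
  qed
  show "voronoi \<Lambda> \<subseteq> cball 0 w"
  proof
    fix x assume "x \<in> voronoi \<Lambda>"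
    then have "norm x \<le> covering_radius \<Lambda>"
      unfolding covering_radius_def using cSUP_upper[OF UNIV_I bd, of x] infdist_voronoi by simp
    then show "x \<in> cball 0 w" using w by simp
  qed
qed

text \<open>If no nonzero lattice vector is shorter than 2w, the triangle inequality keeps the ball
  in the cell. A shorter vector l would leave a point of the ball closer to l than to 0.\<close>

lemma cball_subset_voronoi_iff:
  assumes "w > 0"
  shows "cball 0 w \<subseteq> voronoi \<Lambda> \<longleftrightarrow> w \<le> packing_radius \<Lambda>"
proof
  have bd: "bdd_below (norm ` (\<Lambda> - {0}))" by (rule bdd_belowI[of _ 0]) auto
  assume w: "w \<le> packing_radius \<Lambda>"
  show "cball 0 w \<subseteq> voronoi \<Lambda>"
    unfolding voronoi_def
  proof (intro subsetI CollectI ballI)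
    fix x l :: "real^'n" assume x: "x \<in> cball 0 w" and l: "l \<in> \<Lambda>"
    show "norm x \<le> norm (x - l)"
    proof (cases "l = 0")
      case False
      then have "2 * w \<le> norm l"
        using cINF_lower[OF bd, of l] l w by (simp add: packing_radius_def)
      moreover have "norm l \<le> norm x + norm (x - l)"
        by (metis add.commute diff_add_cancel norm_minus_commute norm_triangle_ineq)
      ultimately show ?thesis using x by simp
    qed simp
  qed
next
  assume sub: "cball 0 w \<subseteq> voronoi \<Lambda>"
  have "2 * w \<le> norm l" if l: "l \<in> \<Lambda> - {0}" for l
  proof (rule ccontr)
    assume "\<not> 2 * w \<le> norm l"
    then have lt: "norm l < 2 * w" "0 < norm l" using l by auto
    \<comment> \<open>\<open>s *\<^sub>R l\<close> is the last point of the segment from 0 to l that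
      stays in the ball; it lies beyond the midpoint because \<open>norm l < 2 * w\<close>.\<close>
    define s where "s = min 1 (w / norm l)"
    have s: "1/2 < s" "s \<le> 1" "s * norm l \<le> w"
      using lt by (auto simp: s_def field_simps min_def)
    have "norm (s *\<^sub>R l) \<le> norm (s *\<^sub>R l - l)"
    proof -
      have "s *\<^sub>R l \<in> cball 0 w" using s by simp
      then show ?thesis using sub l unfolding voronoi_def by blast
    qed
    also have "s *\<^sub>R l - l = (s - 1) *\<^sub>R l" by (simp add: algebra_simps)
    also have "norm \<dots> = (1 - s) * norm l" using s by simp
    finally show False using s lt by (simp add: mult_le_cancel_right)
  qed
  then have "2 * w \<le> (INF l\<in>\<Lambda> - {0}. norm l)"
    using nonzero_mem by (intro cINF_greatest)
  then show "w \<le> packing_radius \<Lambda>" by (simp add: packing_radius_def)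
qed

end

section \<open>Lattices given by a basis, and the dual basis\<close>

lemma lattice_of_eq_image:
  "lattice_of B = range (\<lambda>k::'n \<Rightarrow> int. transpose B *v (\<chi> i. of_int (k i)))" for B :: "real^'n^'n"
  unfolding lattice_of_def matrix_mult_sum
  by (auto simp: column_transpose scalar_mult_eq_scaleR)

text \<open>The inverse \<open>C\<close> of the transposed generator matrix recovers integer
  coordinates. Since it is bounded, a ball admits finitely many coordinate vectors; rounding the
  coordinates of a point down gives a lattice point at bounded distance.\<close>

lemma point_lattice_lattice_of:
  fixes B :: "real^'n^'n"
  assumes "invertible B"
  shows "point_lattice (lattice_of B)"
proof
  obtain C :: "real^'n^'n" where C: "C ** transpose B = mat 1" "transpose B ** C = mat 1"
    using transpose_invertible[OF assms] unfolding invertible_def by auto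
  define v :: "('n \<Rightarrow> int) \<Rightarrow> real^'n" where "v k = (\<chi> i. of_int (k i))" for k
  have L: "lattice_of B = range (\<lambda>k. transpose B *v v k)"
    unfolding lattice_of_eq_image v_def ..
  have "transpose B *v v (\<lambda>i. 0) = 0" by (simp add: v_def zero_vec_def[symmetric])
  then show "0 \<in> lattice_of B" unfolding L by (metis rangeI)
  show "x - y \<in> lattice_of B" if "x \<in> lattice_of B" "y \<in> lattice_of B" for x y
  proof -
    from that obtain k m where "x = transpose B *v v k" "y = transpose B *v v m" unfolding L by auto
    moreover have "v (\<lambda>i. k i - m i) = v k - v m" by (simp add: v_def vec_eq_iff)
    ultimately have "x - y = transpose B *v v (\<lambda>i. k i - m i)"
      by (simp add: matrix_vector_mult_diff_distrib)
    then show ?thesis unfolding L by blast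
  qed
  show "finite (lattice_of B \<inter> cball 0 r)" for r
  proof -
    obtain K where K: "\<And>x. norm (C *v x) \<le> norm x * K"
      using bounded_linear.bounded[OF matrix_vector_mul_bounded_linear[of C]] by auto
    define n where "n = \<lfloor>\<bar>r * K\<bar>\<rfloor>"
    have "lattice_of B \<inter> cball 0 r \<subseteq> (\<lambda>k. transpose B *v v k) ` (PiE UNIV (\<lambda>_. {-n..n}))"
    proof
      fix x assume x: "x \<in> lattice_of B \<inter> cball 0 r"
      then obtain k where k: "x = transpose B *v v k" unfolding L by auto
      then have Cx: "C *v x = v k" by (simp add: matrix_vector_mul_assoc C del: transpose_matrix_vector)
      have "k i \<in> {-n..n}" for i
      proof -
        have "\<bar>of_int (k i)\<bar> \<le> norm (v k)" using component_le_norm_cart[of "v k" i] by (simp add: v_def)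
        also have "\<dots> \<le> norm x * K" using K[of x] Cx by simp
        also have "\<dots> \<le> norm x * \<bar>K\<bar>" by (simp add: mult_left_mono)
        also have "\<dots> \<le> \<bar>r * K\<bar>" using x by (auto simp: abs_mult intro!: mult_right_mono)
        finally have "\<bar>k i\<bar> \<le> n" unfolding n_def by linarith
        then show ?thesis by auto
      qed
      then show "x \<in> (\<lambda>k. transpose B *v v k) ` (PiE UNIV (\<lambda>_. {-n..n}))" using k by auto
    qed
    then show ?thesis by (rule finite_subset) (intro finite_imageI finite_PiE; simp)
  qed
  show "\<exists>R. \<forall>x. \<exists>l\<in>lattice_of B. norm (x - l) \<le> R"
  proof -
    obtain K where K: "K > 0" "\<And>x. norm (transpose B *v x) \<le> norm x * K"
      using bounded_linear.pos_bounded[OF matrix_vector_mul_bounded_linear[of "transpose B"]] by auto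
    have "\<exists>l\<in>lattice_of B. norm (x - l) \<le> real CARD('n) * K" for x
    proof
      define k where "k i = \<lfloor>(C *v x) $ i\<rfloor>" for i
      show "transpose B *v v k \<in> lattice_of B" unfolding L by auto
      have "x - transpose B *v v k = transpose B *v (C *v x - v k)"
        by (simp add: matrix_vector_mult_diff_distrib matrix_vector_mul_assoc C)
      also have "norm \<dots> \<le> norm (C *v x - v k) * K" by (rule K)
      also have "\<dots> \<le> real CARD('n) * K"
      proof (intro mult_right_mono)
        have "norm (C *v x - v k) \<le> (\<Sum>i\<in>UNIV. \<bar>(C *v x - v k) $ i\<bar>)" by (rule norm_le_l1_cart)
        also have "\<dots> \<le> (\<Sum>i\<in>(UNIV::'n set). 1)"
        proof (rule sum_mono)
          fix i show "\<bar>(C *v x - v k) $ i\<bar> \<le> 1" by (simp add: v_def k_def) linarith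
        qed
        finally show "norm (C *v x - v k) \<le> real CARD('n)" by simp
      qed (use K in auto)
      finally show "norm (x - transpose B *v v k) \<le> real CARD('n) * K" .
    qed
    then show ?thesis by blast
  qed
qed

lemma row_mem_lattice_of: "row i B \<in> lattice_of B"
  unfolding lattice_of_def
  by (auto intro!: exI[of _ "\<lambda>j. if j = i then 1 else 0"]
      simp: if_distribR if_distrib[of "\<lambda>c. of_int c *\<^sub>R _"] sum.delta cong: if_cong)

lemma mem_scaled_dual_iff:
  fixes B :: "real^'n^'n"
  shows "l \<in> scaled_dual (lattice_of B) \<longleftrightarrow> (\<forall>i. \<exists>k::int. l \<bullet> row i B = 2 * pi * of_int k)"
proof safe
  fix i assume "l \<in> scaled_dual (lattice_of B)"
  then show "\<exists>k::int. l \<bullet> row i B = 2 * pi * of_int k"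
    using row_mem_lattice_of by (auto simp: scaled_dual_def)
next
  assume "\<forall>i. \<exists>k::int. l \<bullet> row i B = 2 * pi * of_int k"
  then obtain m :: "'n \<Rightarrow> int" where m: "\<And>i. l \<bullet> row i B = 2 * pi * of_int (m i)" by metis
  show "l \<in> scaled_dual (lattice_of B)"
    unfolding scaled_dual_def lattice_of_def
  proof safe
    fix k :: "'n \<Rightarrow> int"
    show "\<exists>j::int. l \<bullet> (\<Sum>i\<in>UNIV. of_int (k i) *\<^sub>R row i B) = 2 * pi * of_int j"
      by (rule exI[of _ "\<Sum>i\<in>UNIV. k i * m i"]) (simp add: inner_sum_right m sum_distrib_left algebra_simps)
  qed
qed

text \<open>\<open>A\<close> is 2 pi times the inverse transpose of \<open>B\<close>, so its rows
  are biorthogonal to those of \<open>B\<close> up to the factor 2 pi. The last conclusion, the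
  resulting coordinate expansion, later reconstructs a point from its angles on the torus.\<close>

lemma dual_basis:
  fixes B :: "real^'n^'n"
  assumes "invertible B"
  obtains A :: "real^'n^'n" where "invertible A"
    "scaled_dual (lattice_of B) = lattice_of A"
    "\<And>x. x = (\<Sum>i\<in>UNIV. (x \<bullet> row i B / (2 * pi)) *\<^sub>R row i A)"
proof -
  obtain C where C: "C ** B = mat 1" "B ** C = mat 1"
    using assms unfolding invertible_def by auto
  define A where "A = (2 * pi) *\<^sub>R transpose C"
  have rowA: "(\<Sum>i\<in>UNIV. c i *\<^sub>R row i A) = (2 * pi) *\<^sub>R (C *v (\<chi> i. c i))" for c
    by (simp add: A_def matrix_mult_sum row_def column_def transpose_def vec_eq_iff sum_distrib_left algebra_simps)
  have BA: "(\<Sum>i\<in>UNIV. c i *\<^sub>R row i A) \<bullet> row j B = 2 * pi * c j" for c j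
  proof -
    have "(B *v (C *v (\<chi> i. c i))) $ j = c j" by (simp add: matrix_vector_mul_assoc C)
    then show ?thesis
      unfolding rowA by (simp add: matrix_vector_mul_component row_def inner_commute)
  qed
  have ex: "x = (\<Sum>i\<in>UNIV. (x \<bullet> row i B / (2 * pi)) *\<^sub>R row i A)" for x
  proof -
    have "(\<chi> i. x \<bullet> row i B / (2 * pi)) = (1 / (2 * pi)) *\<^sub>R (B *v x)"
      by (simp add: vec_eq_iff matrix_vector_mul_component row_def inner_commute)
    then show ?thesis unfolding rowA
      by (simp add: matrix_vector_mult_scaleR matrix_vector_mul_assoc C)
  qed
  show ?thesis
  proof (rule that[of A])
    show "invertible A"
      unfolding A_def invertible_def
      by (rule exI[of _ "(1 / (2 * pi)) *\<^sub>R transpose B"])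
         (simp add: matrix_scalar_ac C flip: matrix_transpose_mul scalar_matrix_assoc)
    show "scaled_dual (lattice_of B) = lattice_of A"
    proof safe
      fix l assume "l \<in> scaled_dual (lattice_of B)"
      then obtain m :: "'n \<Rightarrow> int" where m: "\<And>i. l \<bullet> row i B = 2 * pi * of_int (m i)"
        unfolding mem_scaled_dual_iff by metis
      then show "l \<in> lattice_of A" using ex[of l] by (auto simp: lattice_of_def)
    next
      fix l assume "l \<in> lattice_of A"
      then show "l \<in> scaled_dual (lattice_of B)"
        unfolding mem_scaled_dual_iff using BA by (auto simp: lattice_of_def)
    qed
  qed (rule ex)
qed

section \<open>Periodization over a lattice\<close>

lemma lborel_integral_translate:
  fixes f :: "'a::euclidean_space \<Rightarrow> 'b::{banach, second_countable_topology}"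
  assumes "f \<in> borel_measurable borel"
  shows "(\<integral>x. f (x + a) \<partial>lborel) = (\<integral>x. f x \<partial>lborel)"
proof -
  have "(\<integral>x. f x \<partial>lborel) = (\<integral>x. f x \<partial>distr lborel borel ((+) a))"
    by (simp add: lborel_distr_plus)
  also have "\<dots> = (\<integral>x. f (a + x) \<partial>lborel)"
    using assms by (intro integral_distr) auto
  finally show ?thesis by (simp add: add.commute)
qed

lemma AE_lborel_translate:
  fixes a :: "'a::euclidean_space"
  assumes "AE x in lborel. P x" shows "AE x in lborel. P (x + a)"
proof -
  from assms obtain N where N: "{x. \<not> P x} \<subseteq> N" "N \<in> null_sets lborel"
    by (auto simp: eventually_ae_filter)
  have "AE x in distr lborel borel ((+) a). x \<notin> N"
    using N(2) by (simp add: lborel_distr_plus AE_not_in)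
  then have "AE x in lborel. a + x \<notin> N"
    by (subst (asm) AE_distr_iff) (use N in \<open>auto simp: null_sets_def\<close>)
  then show ?thesis by eventually_elim (use N(1) in \<open>auto simp: add.commute\<close>)
qed

text \<open>Translation invariance of Lebesgue measure lets each point exchange the mass it sends along
  the lattice for the mass it receives; this replaces any use of a fundamental parallelepiped.\<close>

lemma mass_transport:
  fixes k :: "'a::euclidean_space \<Rightarrow> 'a \<Rightarrow> 'b::{banach, second_countable_topology}"
  assumes F: "finite F" "\<And>l. l \<in> F \<Longrightarrow> - l \<in> F"
    and meas: "\<And>l. l \<in> F \<Longrightarrow> (\<lambda>x. k x (x + l)) \<in> borel_measurable borel"
       "\<And>l. l \<in> F \<Longrightarrow> (\<lambda>x. k (x + l) x) \<in> borel_measurable borel"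
    and int: "\<And>l. l \<in> F \<Longrightarrow> integrable lborel (\<lambda>x. k x (x + l))"
       "\<And>l. l \<in> F \<Longrightarrow> integrable lborel (\<lambda>x. k (x + l) x)"
  shows "(\<integral>x. (\<Sum>l\<in>F. k x (x + l)) \<partial>lborel) = (\<integral>x. (\<Sum>l\<in>F. k (x + l) x) \<partial>lborel)"
proof -
  have "(\<integral>x. (\<Sum>l\<in>F. k x (x + l)) \<partial>lborel) = (\<Sum>l\<in>F. \<integral>x. k x (x + l) \<partial>lborel)"
    using int by simp
  \<comment> \<open>The substitution of x - l for x turns the vector from sender to receiver around;
    the symmetry of \<open>F\<close> then absorbs the sign.\<close>
  also have "\<dots> = (\<Sum>l\<in>F. \<integral>x. k (x + - l) x \<partial>lborel)"
  proof (intro sum.cong refl)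
    fix l assume l: "l \<in> F"
    show "(\<integral>x. k x (x + l) \<partial>lborel) = (\<integral>x. k (x + - l) x \<partial>lborel)"
      using lborel_integral_translate[OF meas(1)[OF l], of "- l"] by simp
  qed
  also have "\<dots> = (\<Sum>l\<in>F. \<integral>x. k (x + l) x \<partial>lborel)"
    using F(2) by (intro sum.reindex_bij_witness[of _ uminus uminus]) auto
  also have "\<dots> = (\<integral>x. (\<Sum>l\<in>F. k (x + l) x) \<partial>lborel)"
    using int by simp
  finally show ?thesis .
qed

lemma set_integrable_bounded_borel:
  fixes f :: "'a::euclidean_space \<Rightarrow> 'b::{banach, second_countable_topology}"
  assumes "D \<in> sets borel" "bounded D" "f \<in> borel_measurable borel" "\<And>x. x \<in> D \<Longrightarrow> norm (f x) \<le> M"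
  shows "set_integrable lborel D f"
  unfolding set_integrable_def
  using assms emeasure_bounded_finite[OF assms(2)]
  by (intro integrableI_bounded_set_indicator[where B = M]) auto

context point_lattice
begin

text \<open>Only orbit points in the ball of radius \<open>w\<close> are summed: this is the lattice
  periodization of \<open>h\<close> cut off to the ball, and the sum is finite.\<close>

definition periodize :: "real \<Rightarrow> (real^'n \<Rightarrow> complex) \<Rightarrow> real^'n \<Rightarrow> complex" where
  "periodize w h x = (\<Sum>l | l \<in> \<Lambda> \<and> norm (x + l) \<le> w. h (x + l))"

definition hit_count :: "real \<Rightarrow> real^'n \<Rightarrow> nat" where
  "hit_count w x = card {l \<in> \<Lambda>. norm (x + l) \<le> w}"

lemma hits_subset: "norm x \<le> r \<Longrightarrow> {l \<in> \<Lambda>. norm (x + l) \<le> w} \<subseteq> \<Lambda> \<inter> cball 0 (r + w)"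
proof safe
  fix l assume "norm x \<le> r" "norm (x + l) \<le> w"
  moreover have "norm l \<le> norm x + norm (x + l)"
    by (metis add.commute add_diff_cancel_left' norm_minus_commute norm_triangle_ineq4)
  ultimately show "l \<in> cball 0 (r + w)" by simp
qed

lemma finite_hits: "finite {l \<in> \<Lambda>. norm (x + l) \<le> w}"
  using hits_subset[of x "norm x" w] finite_Int_cball finite_subset by blast

lemma of_nat_hit_count: "of_nat (hit_count w x) = periodize w (\<lambda>_. 1) x"
  by (simp add: hit_count_def periodize_def)

text \<open>The index set no longer depends on x within a ball, so that sums over orbits can be
  integrated termwise.\<close>

lemma periodize_eq_sum:
  assumes "norm x \<le> r"
  shows "periodize w h x = (\<Sum>l\<in>\<Lambda> \<inter> cball 0 (r + w). indicator (cball 0 w) (x + l) * h (x + l))"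
  unfolding periodize_def
  using hits_subset[OF assms, of w] finite_Int_cball
  by (intro sum.mono_neutral_cong_left) (auto simp: indicator_def)

lemma periodize_periodic:
  assumes "m \<in> \<Lambda>" shows "periodize w h (x + m) = periodize w h x"
  unfolding periodize_def
  using assms add_mem diff_mem
  by (intro sum.reindex_bij_witness[of _ "\<lambda>l. l - m" "\<lambda>l. l + m"]) (auto simp: algebra_simps)

lemma hit_count_periodic: "m \<in> \<Lambda> \<Longrightarrow> hit_count w (x + m) = hit_count w x"
  using of_nat_hit_count[of w "x + m"] of_nat_hit_count[of w x] periodize_periodic[of m w _ x]
  by (metis of_nat_eq_iff)

lemma hit_count_pos: "norm x \<le> w \<Longrightarrow> hit_count w x > 0"
  unfolding hit_count_def using finite_hits zero_mem by (auto simp: card_gt_0_iff intro!: exI[of _ 0])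

text \<open>For each x the finite sums over growing index sets are eventually equal to the
  periodization, which is therefore a pointwise limit of Borel functions.\<close>

lemma borel_periodize [measurable]:
  assumes [measurable]: "h \<in> borel_measurable borel"
  shows "periodize w h \<in> borel_measurable borel"
proof (rule borel_measurable_LIMSEQ_metric)
  fix x :: "real^'n"
  have "\<forall>\<^sub>F n in sequentially. norm x \<le> real n"
    by (meson eventually_sequentiallyI nat_ceiling_le_eq)
  then show "(\<lambda>n. \<Sum>l\<in>\<Lambda> \<inter> cball 0 (real n + w). indicator (cball 0 w) (x + l) * h (x + l))
      \<longlonglongrightarrow> periodize w h x"
    by (intro tendsto_eventually) (auto elim!: eventually_mono simp: periodize_eq_sum)
next
  fix n :: nat
  have [measurable]: "cball (0::real^'n) w \<in> sets borel" by simp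
  have "(\<lambda>x. indicator (cball 0 w) (x + l) * h (x + l)) \<in> borel_measurable borel" for l
    by measurable
  then show "(\<lambda>x. \<Sum>l\<in>\<Lambda> \<inter> cball 0 (real n + w). indicator (cball 0 w) (x + l) * h (x + l))
      \<in> borel_measurable borel"
    by (intro borel_measurable_sum)
qed

lemma borel_hit_count [measurable]: "(\<lambda>x. of_nat (hit_count w x) :: complex) \<in> borel_measurable borel"
  unfolding of_nat_hit_count by measurable

text \<open>Against a periodic \<open>q\<close>, a function on the ball may be replaced by its mean
  over the orbit points in the ball. This makes the orbit mean the orthogonal projection onto
  periodic functions. In terms of mass transport, every point passes on its mass in equal shares to
  the points of its orbit in the ball.\<close>

lemma integral_periodize:
  assumes h [measurable]: "h \<in> borel_measurable borel" and q [measurable]: "q \<in> borel_measurable borel"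
    and hb: "\<And>x. norm (h x) \<le> H" and qb: "\<And>x. norm (q x) \<le> Q"
    and qp: "\<And>x l. l \<in> \<Lambda> \<Longrightarrow> q (x + l) = q x"
  shows "(LINT x:cball 0 w|lborel. h x * q x)
       = (LINT x:cball 0 w|lborel. periodize w h x / of_nat (hit_count w x) * q x)"
proof -
  \<comment> \<open>Two points of the ball differ by a vector of norm at most 2w, so
    \<open>F\<close> contains every translation that can occur.\<close>
  define F where "F = \<Lambda> \<inter> cball 0 (w + w)"
  define I :: "real^'n \<Rightarrow> complex" where "I = indicator (cball 0 w)"
  have I [measurable]: "I \<in> borel_measurable borel" unfolding I_def by (intro borel_measurable_indicator) auto
  \<comment> \<open>\<open>k x y\<close> is the share that x receives from y; both indicators
    restrict the exchange to the ball.\<close>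
  define k where "k x y = I x * (I y * h y * q x / of_nat (hit_count w x))" for x y
  have F: "finite F" unfolding F_def by (rule finite_Int_cball)
  have H: "H \<ge> 0" "Q \<ge> 0" using hb[of 0] qb[of 0] norm_ge_zero order_trans by blast+
  \<comment> \<open>The case n = 0 is covered by the convention that 1 / 0 = 0.\<close>
  have inv: "norm (1 / of_nat n :: complex) \<le> 1" for n :: nat
    by (cases "n = 0") (auto simp: norm_divide)
  have nI: "norm (I x) \<le> 1" for x by (simp add: I_def indicator_def)
  have kb: "norm (I y * h y * q x / of_nat (hit_count w x)) \<le> 1 * H * Q * 1" for x y
  proof -
    have "norm (I y * h y * q x / of_nat (hit_count w x))
        = norm (I y) * norm (h y) * norm (q x) * norm (1 / of_nat (hit_count w x) :: complex)"
      by (simp add: norm_mult norm_divide)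
    also have "\<dots> \<le> 1 * H * Q * 1"
      using H nI hb qb inv by (intro mult_mono mult_nonneg_nonneg) auto
    finally show ?thesis .
  qed
  have int1: "integrable lborel (\<lambda>x. k x (x + l))" for l
  proof -
    have "set_integrable lborel (cball 0 w) (\<lambda>x. I (x + l) * h (x + l) * q x / of_nat (hit_count w x))"
      by (rule set_integrable_bounded_borel[where M = "1 * H * Q * 1"]) (use kb in auto)
    moreover have "(\<lambda>x. k x (x + l))
        = (\<lambda>x. indicator (cball 0 w) x *\<^sub>R (I (x + l) * h (x + l) * q x / of_nat (hit_count w x)))"
      by (auto simp: k_def I_def indicator_def)
    ultimately show ?thesis unfolding set_integrable_def by simp
  qed
  have int2: "integrable lborel (\<lambda>x. k (x + l) x)" for l
  proof -
    have "set_integrable lborel (cball 0 w) (\<lambda>x. I (x + l) * (h x * q (x + l) / of_nat (hit_count w (x + l))))"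
    proof (rule set_integrable_bounded_borel[where M = "1 * (1 * H * Q * 1)"])
      fix x :: "real^'n" assume "x \<in> cball 0 w"
      then have "I x = 1" by (simp add: I_def)
      then show "norm (I (x + l) * (h x * q (x + l) / of_nat (hit_count w (x + l)))) \<le> 1 * (1 * H * Q * 1)"
        unfolding norm_mult[of "I (x + l)"] using nI[of "x + l"] kb[of x "x + l"] by (intro mult_mono) auto
    qed auto
    moreover have "(\<lambda>x. k (x + l) x)
        = (\<lambda>x. indicator (cball 0 w) x *\<^sub>R (I (x + l) * (h x * q (x + l) / of_nat (hit_count w (x + l)))))"
      by (auto simp: k_def I_def indicator_def)
    ultimately show ?thesis unfolding set_integrable_def by simp
  qed
  have "(LINT x:cball 0 w|lborel. periodize w h x / of_nat (hit_count w x) * q x)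
      = (\<integral>x. (\<Sum>l\<in>F. k x (x + l)) \<partial>lborel)"
    unfolding set_lebesgue_integral_def
  proof (intro Bochner_Integration.integral_cong refl)
    fix x :: "real^'n"
    show "indicator (cball 0 w) x *\<^sub>R (periodize w h x / of_nat (hit_count w x) * q x) = (\<Sum>l\<in>F. k x (x + l))"
    proof (cases "norm x \<le> w")
      case True
      then show ?thesis
        unfolding periodize_eq_sum[OF True] F_def k_def I_def
        by (simp add: sum_distrib_left sum_distrib_right sum_divide_distrib mult_ac)
    qed (simp add: k_def I_def)
  qed
  also have "\<dots> = (\<integral>x. (\<Sum>l\<in>F. k (x + l) x) \<partial>lborel)"
  proof (rule mass_transport[OF F])
    show "- l \<in> F" if "l \<in> F" for l using that uminus_mem by (simp add: F_def)
  qed (use int1 int2 in \<open>auto simp: k_def\<close>)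
  also have "\<dots> = (LINT x:cball 0 w|lborel. h x * q x)"
    unfolding set_lebesgue_integral_def
  proof (intro Bochner_Integration.integral_cong refl)
    fix x :: "real^'n"
    show "(\<Sum>l\<in>F. k (x + l) x) = indicator (cball 0 w) x *\<^sub>R (h x * q x)"
    proof (cases "norm x \<le> w")
      case True
      \<comment> \<open>\<open>q\<close> and \<open>hit_count\<close> are constant on the orbit, so
        all \<open>hit_count w x\<close> nonzero terms agree and the division by the count
        cancels.\<close>
      have "(\<Sum>l\<in>F. k (x + l) x) = (\<Sum>l\<in>F. I (x + l) * (h x * q x / of_nat (hit_count w x)))"
        using True by (intro sum.cong) (auto simp: k_def F_def qp hit_count_periodic I_def)
      also have "\<dots> = of_nat (hit_count w x) * (h x * q x / of_nat (hit_count w x))"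
        unfolding sum_distrib_right[symmetric]
        by (simp add: of_nat_hit_count periodize_eq_sum[OF True] F_def I_def)
      finally show ?thesis using True hit_count_pos[OF True] by simp
    qed (simp add: k_def I_def)
  qed
  finally show ?thesis ..
qed

text \<open>Almost every orbit meets the shifted cell in exactly one point. The premise places that
  point in the ball, so the truncated sum does not miss it.\<close>

lemma AE_periodize_voronoi:
  "AE x in lborel. (\<exists>l\<in>\<Lambda>. x + s + l \<in> voronoi \<Lambda> \<and> norm (x + l) \<le> w) \<longrightarrow>
     periodize w (\<lambda>y. indicator (voronoi \<Lambda>) (y + s)) x = 1"
  using AE_lborel_translate[OF AE_voronoi_unique, of s]
proof eventually_elim
  case (elim x)
  show ?case
  proof
    assume "\<exists>l\<in>\<Lambda>. x + s + l \<in> voronoi \<Lambda> \<and> norm (x + l) \<le> w"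
    then obtain l where l: "l \<in> \<Lambda>" "x + s + l \<in> voronoi \<Lambda>" "norm (x + l) \<le> w" by auto
    have "periodize w (\<lambda>y. indicator (voronoi \<Lambda>) (y + s)) x
        = (\<Sum>m | m \<in> \<Lambda> \<and> norm (x + m) \<le> w. if m = l then 1 else 0)"
      unfolding periodize_def
      using elim l by (intro sum.cong refl) (auto simp: indicator_def algebra_simps)
    also have "\<dots> = 1" using l finite_hits by (subst sum.delta) auto
    finally show "periodize w (\<lambda>y. indicator (voronoi \<Lambda>) (y + s)) x = 1" .
  qed
qed

text \<open>The periodized indicator of the cell is 1 almost everywhere on the ball, so it can be
  inserted as numerator; \<open>integral_periodize\<close> with q = 1 then undoes the
  averaging.\<close>

lemma integral_inverse_hit_count:
  "(LINT x:cball 0 w|lborel. 1 / of_nat (hit_count w x) :: complex)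
     = of_real (measure lborel (cball 0 w \<inter> voronoi \<Lambda>))"
proof -
  have "(LINT x:cball 0 w|lborel. 1 / of_nat (hit_count w x) :: complex)
      = (LINT x:cball 0 w|lborel. periodize w (indicator (voronoi \<Lambda>)) x / of_nat (hit_count w x) * 1)"
  proof (rule set_lebesgue_integral_cong_AE)
    show "AE x\<in>cball 0 w in lborel. 1 / of_nat (hit_count w x)
        = periodize w (indicator (voronoi \<Lambda>)) x / of_nat (hit_count w x) * (1::complex)"
      using AE_periodize_voronoi[of 0 w]
    proof eventually_elim
      case (elim x)
      show ?case
      proof
        assume x: "x \<in> cball 0 w"
        obtain l where l: "l \<in> \<Lambda>" "x + l \<in> voronoi \<Lambda>" using nearest .
        \<comment> \<open>The point of the cell has least norm in its orbit, hence stays in the ball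
          when x does.\<close>
        then have "norm (x + l) \<le> norm (x + l - l)" unfolding voronoi_def by blast
        then have "norm (x + l) \<le> w" using x by simp
        then have "periodize w (indicator (voronoi \<Lambda>)) x = 1" using elim l by auto
        then show "1 / of_nat (hit_count w x)
          = periodize w (indicator (voronoi \<Lambda>)) x / of_nat (hit_count w x) * (1::complex)" by simp
      qed
    qed
  qed auto
  also have "\<dots> = (LINT x:cball 0 w|lborel. indicator (voronoi \<Lambda>) x * 1)"
    by (rule integral_periodize[symmetric, where H = 1 and Q = 1]) (auto simp: indicator_def)
  also have "\<dots> = (\<integral>x. indicator (cball 0 w \<inter> voronoi \<Lambda>) x *\<^sub>R 1 \<partial>lborel)"
    unfolding set_lebesgue_integral_def
    by (intro Bochner_Integration.integral_cong) (auto simp: indicator_def)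
  also have "\<dots> = of_real (measure lborel (cball 0 w \<inter> voronoi \<Lambda>))"
    by (subst integral_scaleR_left) (auto intro!: integrable_real_indicator emeasure_bounded_finite simp: of_real_def)
  finally show ?thesis .
qed

text \<open>Translates of the cell are fundamental domains too. Both integrals equal that of
  \<open>h\<close> divided by the hit count over one large ball, an expression in which the
  translation no longer occurs.\<close>

lemma integral_voronoi_translate:
  assumes h [measurable]: "h \<in> borel_measurable borel" and hb: "\<And>x. norm (h x) \<le> H"
    and hp: "\<And>x l. l \<in> \<Lambda> \<Longrightarrow> h (x + l) = (h x :: complex)"
  shows "(LINT x:voronoi \<Lambda>|lborel. h (x - s)) = (LINT x:voronoi \<Lambda>|lborel. h x)"
proof -
  obtain R where R: "R > 0" "voronoi \<Lambda> \<subseteq> cball 0 R" using bounded_voronoi .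
  \<comment> \<open>This radius makes the ball contain the cell as well as its translate by -s, so
    the same ball serves a = s and a = 0.\<close>
  define w where "w = R + norm s"
  have *: "(LINT x:voronoi \<Lambda>|lborel. h (x - a)) = (LINT x:cball 0 w|lborel. 1 / of_nat (hit_count w x) * h x)"
    if "norm a \<le> norm s" for a
  proof -
    have V: "norm (x - a) \<le> w" if "x \<in> voronoi \<Lambda>" for x
      using R(2) that \<open>norm a \<le> norm s\<close> norm_triangle_ineq4[of x a] by (force simp: w_def)
    have "(LINT x:voronoi \<Lambda>|lborel. h (x - a)) = (\<integral>x. indicator (voronoi \<Lambda>) (x + a) *\<^sub>R h (x + a - a) \<partial>lborel)"
      unfolding set_lebesgue_integral_def by (rule lborel_integral_translate[symmetric]) measurable
    also have "\<dots> = (LINT x:cball 0 w|lborel. indicator (voronoi \<Lambda>) (x + a) * h x)"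
      unfolding set_lebesgue_integral_def
      using V[of "_ + a"] by (intro Bochner_Integration.integral_cong) (auto simp: indicator_def)
    also have "\<dots> = (LINT x:cball 0 w|lborel.
        periodize w (\<lambda>x. indicator (voronoi \<Lambda>) (x + a)) x / of_nat (hit_count w x) * h x)"
      by (rule integral_periodize[where H = 1 and Q = H]) (auto simp: indicator_def hb hp)
    also have "\<dots> = (LINT x:cball 0 w|lborel. 1 / of_nat (hit_count w x) * h x)"
    proof (rule set_lebesgue_integral_cong_AE)
      show "AE x\<in>cball 0 w in lborel. periodize w (\<lambda>x. indicator (voronoi \<Lambda>) (x + a)) x / of_nat (hit_count w x) * h x
          = 1 / of_nat (hit_count w x) * h x"
        using AE_periodize_voronoi[of a w]
      proof eventually_elim
        case (elim x)
        obtain l where l: "l \<in> \<Lambda>" "x + a + l \<in> voronoi \<Lambda>" using nearest .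
        then have "norm (x + l) \<le> w" using V[of "x + a + l"] by (simp add: algebra_simps)
        then show ?case using elim l by auto
      qed
    qed auto
    finally show ?thesis .
  qed
  show ?thesis using *[of s] *[of 0] by simp
qed

end

section \<open>Trigonometric polynomials\<close>

text \<open>For l in the dual lattice the character is periodic, so its integral is unchanged under
  translation. A translation through half a period changes its sign, so for nonzero l the integral
  vanishes.\<close>

lemma integral_voronoi_character:
  fixes B :: "real^'n^'n"
  assumes "invertible B" and l: "l \<in> scaled_dual (lattice_of B)"
  shows "(LINT t:voronoi (lattice_of B)|lborel. cis (l \<bullet> t))
       = (if l = 0 then of_real (measure lborel (voronoi (lattice_of B))) else 0)"
proof -
  interpret point_lattice "lattice_of B" using assms(1) by (rule point_lattice_lattice_of)
  show ?thesis
  proof (cases "l = 0")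
    case True
    then show ?thesis
      using lmeasurable_voronoi
      by (simp add: set_lebesgue_integral_def of_real_def fmeasurable_def)
  next
    case False
    define I where "I = (LINT t:voronoi (lattice_of B)|lborel. cis (l \<bullet> t))"
    define s where "s = (pi / (l \<bullet> l)) *\<^sub>R l"
    have s: "l \<bullet> s = pi" using False by (simp add: s_def)
    have "I = (LINT t:voronoi (lattice_of B)|lborel. cis (l \<bullet> (t - s)))"
      unfolding I_def
    proof (rule integral_voronoi_translate[where H = 1, symmetric])
      show "(\<lambda>t. cis (l \<bullet> t)) \<in> borel_measurable borel"
        by (intro borel_measurable_continuous_onI continuous_intros)
      fix t b :: "real^'n" assume "b \<in> lattice_of B"
      then obtain k :: int where "l \<bullet> b = 2 * pi * of_int k"
        using l by (auto simp: scaled_dual_def)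
      then show "cis (l \<bullet> (t + b)) = cis (l \<bullet> t)"
        by (simp add: inner_add_right cis_mult[symmetric])
    qed simp
    also have "\<dots> = (LINT t:voronoi (lattice_of B)|lborel. - 1 * cis (l \<bullet> t))"
      by (simp add: inner_diff_right s cis_divide[symmetric])
    also have "\<dots> = - I" unfolding I_def by (subst set_integral_mult_right) auto
    finally show ?thesis using False by (simp add: I_def)
  qed
qed

text \<open>The spectral counterpart of \<open>sample_span\<close>: the sample at b corresponds to
  the character x \<mapsto> \<open>cis (x \<bullet> b)\<close> of the frequency variable x.\<close>

definition trig_polynomial :: "(real^'n) set \<Rightarrow> (real^'n \<Rightarrow> complex) \<Rightarrow> bool" where
  "trig_polynomial L p \<longleftrightarrow> (\<exists>F c. finite F \<and> F \<subseteq> L \<and> p = (\<lambda>x. \<Sum>b\<in>F. c b * cis (x \<bullet> b)))"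

lemma continuous_trig_polynomial: "trig_polynomial L p \<Longrightarrow> continuous_on UNIV p"
  by (auto simp: trig_polynomial_def intro!: continuous_intros)

lemma trig_polynomial_bounded:
  assumes "trig_polynomial L p" obtains M where "\<And>x. norm (p x) \<le> M"
proof -
  obtain F c where p: "p = (\<lambda>x. \<Sum>b\<in>F. c b * cis (x \<bullet> b))"
    using assms by (auto simp: trig_polynomial_def)
  have "norm (p x) \<le> (\<Sum>b\<in>F. norm (c b))" for x
    unfolding p by (rule order.trans[OF norm_sum]) (simp add: norm_mult)
  then show ?thesis using that by blast
qed

lemma trig_polynomial_periodic:
  assumes "trig_polynomial L p" "l \<in> scaled_dual L"
  shows "p (x + l) = p x"
proof -
  obtain F c where p: "F \<subseteq> L" "p = (\<lambda>x. \<Sum>b\<in>F. c b * cis (x \<bullet> b))"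
    using assms by (auto simp: trig_polynomial_def)
  have "cis ((x + l) \<bullet> b) = cis (x \<bullet> b)" if "b \<in> L" for b
  proof -
    obtain k :: int where "l \<bullet> b = 2 * pi * of_int k"
      using assms(2) \<open>b \<in> L\<close> by (auto simp: scaled_dual_def)
    then show ?thesis by (simp add: inner_add_left cis_mult[symmetric])
  qed
  then show ?thesis using p by (auto intro!: sum.cong)
qed

lemma trig_polynomial_monomial: "b \<in> L \<Longrightarrow> trig_polynomial L (\<lambda>x. c * cis (x \<bullet> b))"
  unfolding trig_polynomial_def by (intro exI[of _ "{b}"] exI[of _ "\<lambda>_. c"]) auto

lemma trig_polynomial_add:
  assumes "trig_polynomial L p" "trig_polynomial L q"
  shows "trig_polynomial L (\<lambda>x. p x + q x)"
proof -
  obtain F c where p: "finite F" "F \<subseteq> L" "p = (\<lambda>x. \<Sum>b\<in>F. c b * cis (x \<bullet> b))"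
    using assms(1) by (auto simp: trig_polynomial_def)
  obtain G d where q: "finite G" "G \<subseteq> L" "q = (\<lambda>x. \<Sum>b\<in>G. d b * cis (x \<bullet> b))"
    using assms(2) by (auto simp: trig_polynomial_def)
  define e where "e b = (if b \<in> F then c b else 0) + (if b \<in> G then d b else 0)" for b
  have "p x + q x = (\<Sum>b\<in>F \<union> G. e b * cis (x \<bullet> b))" for x
  proof -
    have "p x = (\<Sum>b\<in>F \<union> G. (if b \<in> F then c b else 0) * cis (x \<bullet> b))"
      unfolding p using p(1) q(1) by (intro sum.mono_neutral_cong_left) auto
    moreover have "q x = (\<Sum>b\<in>F \<union> G. (if b \<in> G then d b else 0) * cis (x \<bullet> b))"
      unfolding q using p(1) q(1) by (intro sum.mono_neutral_cong_left) auto
    ultimately show ?thesis by (simp add: e_def distrib_right sum.distrib)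
  qed
  then show ?thesis
    unfolding trig_polynomial_def using p q by (intro exI[of _ "F \<union> G"] exI[of _ e]) auto
qed

lemma trig_polynomial_sum:
  "finite I \<Longrightarrow> (\<And>i. i \<in> I \<Longrightarrow> trig_polynomial L (f i)) \<Longrightarrow> trig_polynomial L (\<lambda>x. \<Sum>i\<in>I. f i x)"
proof (induction I rule: finite_induct)
  case empty
  show ?case unfolding trig_polynomial_def by (intro exI[of _ "{}"]) auto
qed (auto intro: trig_polynomial_add)

lemma trig_polynomial_cmul:
  assumes "trig_polynomial L p" shows "trig_polynomial L (\<lambda>x. a * p x)"
proof -
  obtain F c where p: "finite F" "F \<subseteq> L" "p = (\<lambda>x. \<Sum>b\<in>F. c b * cis (x \<bullet> b))"
    using assms(1) by (auto simp: trig_polynomial_def)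
  then show ?thesis
    unfolding trig_polynomial_def
    by (intro exI[of _ F] exI[of _ "\<lambda>b. a * c b"]) (auto simp: sum_distrib_left mult_ac)
qed

lemma (in point_lattice) trig_polynomial_mult:
  assumes "trig_polynomial \<Lambda> p" "trig_polynomial \<Lambda> q"
  shows "trig_polynomial \<Lambda> (\<lambda>x. p x * q x)"
proof -
  obtain F c where p: "finite F" "F \<subseteq> \<Lambda>" "p = (\<lambda>x. \<Sum>b\<in>F. c b * cis (x \<bullet> b))"
    using assms(1) by (auto simp: trig_polynomial_def)
  obtain G d where q: "finite G" "G \<subseteq> \<Lambda>" "q = (\<lambda>x. \<Sum>b\<in>G. d b * cis (x \<bullet> b))"
    using assms(2) by (auto simp: trig_polynomial_def)
  have eq: "(\<lambda>x. p x * q x) = (\<lambda>x. \<Sum>a\<in>F. \<Sum>b\<in>G. (c a * d b) * cis (x \<bullet> (a + b)))"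
    unfolding p q by (simp add: sum_product inner_add_right cis_mult[symmetric] mult_ac)
  show ?thesis
    unfolding eq using p q add_mem by (intro trig_polynomial_sum trig_polynomial_monomial) auto
qed

section \<open>Density of trigonometric polynomials via the torus\<close>

text \<open>The quotient by the scaled dual lattice, realized as a bounded subset of a Euclidean
  space so that polynomial approximation is available there.\<close>

definition torus_map :: "real^'n^'n \<Rightarrow> real^'n \<Rightarrow> complex^'n" where
  "torus_map B x = (\<chi> j. cis (x \<bullet> row j B))"

lemma continuous_torus_map: "continuous_on UNIV (torus_map B)"
  unfolding torus_map_def by (intro continuous_intros)

lemma borel_torus_map [measurable]: "torus_map B \<in> borel_measurable borel"
  by (rule borel_measurable_continuous_onI[OF continuous_torus_map])

lemma norm_torus_map: "norm (torus_map B x :: complex^'n) \<le> real CARD('n)"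
proof -
  have "norm (torus_map B x :: complex^'n) \<le> (\<Sum>j\<in>(UNIV::'n set). norm (torus_map B x $ j))"
    by (simp add: norm_vec_def L2_set_le_sum)
  then show ?thesis by (simp add: torus_map_def)
qed

text \<open>A real-linear functional of the torus coordinates is a combination of cosines and sines
  of the angles \<open>x \<bullet> row j B\<close>. Euler's formula turns these into characters at
  plus and minus the rows, and sums and products stay in the algebra because the lattice is closed
  under addition.\<close>

lemma trig_polynomial_real_polynomial:
  fixes B :: "real^'n^'n"
  assumes "invertible B" "real_polynomial_function p"
  shows "trig_polynomial (lattice_of B) (\<lambda>x. of_real (p (torus_map B x)))"
proof -
  interpret point_lattice "lattice_of B" using assms(1) by (rule point_lattice_lattice_of)
  from assms(2) show ?thesis
  proof (induction p rule: real_polynomial_function.induct)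
    case (linear f)
    interpret f: bounded_linear f by fact
    have expand: "f z = (\<Sum>j\<in>UNIV. Re (z $ j) * f (axis j 1) + Im (z $ j) * f (axis j \<i>))" for z
    proof -
      have "z = (\<Sum>j\<in>UNIV. Re (z $ j) *\<^sub>R axis j 1 + Im (z $ j) *\<^sub>R axis j \<i>)"
        by (simp add: vec_eq_iff axis_def if_distrib[of "\<lambda>c. _ *\<^sub>R c"] sum.distrib complex_eq_iff cong: if_cong)
      then have "f z = f (\<Sum>j\<in>UNIV. Re (z $ j) *\<^sub>R axis j 1 + Im (z $ j) *\<^sub>R axis j \<i>)" by simp
      then show ?thesis by (simp add: f.sum f.add f.scaleR)
    qed
    have euler: "complex_of_real (cos t * a + sin t * b)
        = (of_real a / 2 - \<i> * of_real b / 2) * cis t + (of_real a / 2 + \<i> * of_real b / 2) * cis (- t)" for t a b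
      by (simp add: complex_eq_iff)
    have eq: "(\<lambda>x. complex_of_real (f (torus_map B x)))
      = (\<lambda>x. \<Sum>j\<in>UNIV. (of_real (f (axis j 1)) / 2 - \<i> * of_real (f (axis j \<i>)) / 2) * cis (x \<bullet> row j B)
          + (of_real (f (axis j 1)) / 2 + \<i> * of_real (f (axis j \<i>)) / 2) * cis (x \<bullet> (- row j B)))"
      unfolding expand[of "torus_map B _"] unfolding torus_map_def
      by (simp only: vec_lambda_beta cis.sel of_real_sum euler inner_minus_right)
    show ?case
      unfolding eq
      by (intro trig_polynomial_sum trig_polynomial_add trig_polynomial_monomial
          row_mem_lattice_of uminus_mem) auto
  next
    case (const c)
    then show ?case using trig_polynomial_monomial[OF zero_mem, of "of_real c"] by simp
  next
    case (add f g)
    then show ?case using trig_polynomial_add by fastforce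
  next
    case (mult f g)
    then show ?case using trig_polynomial_mult by fastforce
  qed
qed

text \<open>A Borel section of \<open>torus_map\<close>, so that every periodic Borel function factors through the torus.\<close>

lemma torus_map_inverse:
  fixes B :: "real^'n^'n"
  assumes "invertible B"
  shows "\<exists>\<psi> \<in> borel_measurable borel. \<forall>x. \<psi> (torus_map B x) - x \<in> scaled_dual (lattice_of B)"
proof -
  obtain A where A: "invertible A" "scaled_dual (lattice_of B) = lattice_of A"
    "\<And>x. x = (\<Sum>i\<in>UNIV. (x \<bullet> row i B / (2 * pi)) *\<^sub>R row i A)"
    using dual_basis[OF assms] by blast
  \<comment> \<open>The principal logarithm returns each angle up to a multiple of 2 pi; the
    expansion in the dual basis therefore recovers x up to a vector of
    \<open>lattice_of A\<close>.\<close>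
  define \<psi> where "\<psi> z = (\<Sum>i\<in>UNIV. (Im (Ln (z $ i)) / (2 * pi)) *\<^sub>R row i A)" for z :: "complex^'n"
  have "\<psi> \<in> borel_measurable borel"
  proof -
    have [measurable]: "(\<lambda>z::complex^'n. z $ i) \<in> borel_measurable borel" for i
      by (intro borel_measurable_continuous_onI continuous_intros)
    show ?thesis unfolding \<psi>_def by measurable
  qed
  moreover have "\<psi> (torus_map B x) - x \<in> scaled_dual (lattice_of B)" for x
  proof -
    have "\<exists>k::int. Im (Ln (cis t)) = t + 2 * pi * of_int k" for t
    proof -
      have "exp (Ln (cis t)) = exp (\<i> * of_real t)" by (simp add: cis_conv_exp)
      then obtain k :: int where "Ln (cis t) = \<i> * of_real t + of_int (2 * k) * (of_real pi * \<i>)"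
        unfolding exp_eq by (auto simp: mult_ac)
      then have "Im (Ln (cis t)) = t + 2 * pi * of_int k" by simp
      then show ?thesis ..
    qed
    then obtain k :: "real \<Rightarrow> int" where k: "\<And>t. Im (Ln (cis t)) = t + 2 * pi * of_int (k t)" by metis
    have "\<psi> (torus_map B x) = (\<Sum>i\<in>UNIV. (x \<bullet> row i B / (2 * pi)) *\<^sub>R row i A
        + of_int (k (x \<bullet> row i B)) *\<^sub>R row i A)"
      unfolding \<psi>_def torus_map_def by (simp add: k add_divide_distrib scaleR_add_left)
    then have "\<psi> (torus_map B x) - x = (\<Sum>i\<in>UNIV. of_int (k (x \<bullet> row i B)) *\<^sub>R row i A)"
      by (simp add: sum.distrib A(3)[symmetric])
    then show ?thesis by (auto simp: A(2) lattice_of_def[of A])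
  qed
  ultimately show ?thesis by blast
qed

text \<open>A periodic \<open>g\<close> factors as \<open>g\<close> after \<open>\<psi>\<close>
  after \<open>torus_map B\<close>. Real and imaginary parts of the outer factor are approximated by
  polynomials in mean square for the image measure on the torus, and pulling these back gives
  trigonometric polynomials.\<close>

theorem trig_polynomial_dense:
  fixes B :: "real^'n^'n" and g :: "real^'n \<Rightarrow> complex"
  assumes "invertible B" and g [measurable]: "g \<in> borel_measurable borel" and gM: "\<And>x. norm (g x) \<le> M"
    and gp: "\<And>x l. l \<in> scaled_dual (lattice_of B) \<Longrightarrow> g (x + l) = g x" and e: "\<epsilon> > 0"
  obtains p where "trig_polynomial (lattice_of B) p"
    "(LINT x:cball 0 w|lborel. (cmod (g x - p x))\<^sup>2) < \<epsilon>"
proof -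
  obtain \<psi> :: "complex^'n \<Rightarrow> real^'n" where [measurable]: "\<psi> \<in> borel_measurable borel"
    and \<psi>: "\<And>x. \<psi> (torus_map B x) - x \<in> scaled_dual (lattice_of B)"
    using torus_map_inverse[OF assms(1)] by metis
  have g\<psi>: "g (\<psi> (torus_map B x)) = g x" for x
    using gp[OF \<psi>[of x], of x] by simp
  define \<mu> where "\<mu> = restrict_space lborel (cball (0::real^'n) w)"
  define \<nu> where "\<nu> = distr \<mu> borel (torus_map B)"
  have [measurable]: "torus_map B \<in> \<mu> \<rightarrow>\<^sub>M borel"
    unfolding \<mu>_def by (rule measurable_restrict_space1) auto
  interpret \<mu>: finite_measure \<mu>
    using emeasure_bounded_finite[of "cball (0::real^'n) w"]
    by (intro finite_measureI) (simp add: \<mu>_def emeasure_restrict_space)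
  interpret \<nu>: finite_measure \<nu>
    unfolding \<nu>_def by (rule \<mu>.finite_measure_distr) measurable
  interpret compactly_supported_measure \<nu> "cball 0 (real CARD('n))"
  proof unfold_locales
    show "AE x in \<nu>. x \<in> cball 0 (real CARD('n))"
      unfolding \<nu>_def by (subst AE_distr_iff) (auto simp: norm_torus_map)
  qed (auto simp: \<nu>_def)
  have R: "approximable (\<lambda>z. Re (g (\<psi> z)))" and I: "approximable (\<lambda>z. Im (g (\<psi> z)))"
    using order_trans[OF abs_Re_le_cmod gM] order_trans[OF abs_Im_le_cmod gM]
    by (auto intro!: approximable_bounded_borel[where M = M])
  obtain p1 where p1: "real_polynomial_function p1" "(\<integral>z. (Re (g (\<psi> z)) - p1 z)\<^sup>2 \<partial>\<nu>) < \<epsilon>/2"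
    using R e unfolding approximable_def by (meson half_gt_zero)
  obtain p2 where p2: "real_polynomial_function p2" "(\<integral>z. (Im (g (\<psi> z)) - p2 z)\<^sup>2 \<partial>\<nu>) < \<epsilon>/2"
    using I e unfolding approximable_def by (meson half_gt_zero)
  define p where "p x = of_real (p1 (torus_map B x)) + \<i> * of_real (p2 (torus_map B x))" for x
  have "trig_polynomial (lattice_of B) p"
    unfolding p_def using assms(1) p1 p2
    by (intro trig_polynomial_add trig_polynomial_cmul trig_polynomial_real_polynomial)
  moreover have "(LINT x:cball 0 w|lborel. (cmod (g x - p x))\<^sup>2) < \<epsilon>"
  proof -
    have adm: "admissible (\<lambda>z. (Re (g (\<psi> z)) - p1 z)\<^sup>2)" "admissible (\<lambda>z. (Im (g (\<psi> z)) - p2 z)\<^sup>2)"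
      using R I p1 p2 by (simp_all add: approximable_def admissible_power2 admissible_diff admissible_poly)
    have "(LINT x:cball 0 w|lborel. (cmod (g x - p x))\<^sup>2) = (\<integral>x. (cmod (g x - p x))\<^sup>2 \<partial>\<mu>)"
      unfolding \<mu>_def by (subst integral_restrict_space) (auto simp: set_lebesgue_integral_def)
    also have "\<dots> = (\<integral>x. (Re (g (\<psi> (torus_map B x))) - p1 (torus_map B x))\<^sup>2
        + (Im (g (\<psi> (torus_map B x))) - p2 (torus_map B x))\<^sup>2 \<partial>\<mu>)"
      unfolding g\<psi> by (simp add: cmod_power2 p_def)
    also have "\<dots> = (\<integral>z. (Re (g (\<psi> z)) - p1 z)\<^sup>2 + (Im (g (\<psi> z)) - p2 z)\<^sup>2 \<partial>\<nu>)"
      unfolding \<nu>_def using adm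
      by (intro integral_distr[symmetric] borel_measurable_add) (auto simp: admissible_def)
    also have "\<dots> = (\<integral>z. (Re (g (\<psi> z)) - p1 z)\<^sup>2 \<partial>\<nu>) + (\<integral>z. (Im (g (\<psi> z)) - p2 z)\<^sup>2 \<partial>\<nu>)"
      using adm by (intro Bochner_Integration.integral_add admissible_integrable)
    also have "\<dots> < \<epsilon>" using p1 p2 by simp
    finally show ?thesis .
  qed
  ultimately show ?thesis using that by blast
qed

section \<open>The error in the spectral domain\<close>

lemma
  fixes f :: "'i \<Rightarrow> 'a \<Rightarrow> 'b::{banach, second_countable_topology}"
  assumes "\<And>i. i \<in> I \<Longrightarrow> set_integrable M A (f i)"
  shows set_integrable_sum: "set_integrable M A (\<lambda>x. \<Sum>i\<in>I. f i x)"
    and set_integral_sum: "(LINT x:A|M. \<Sum>i\<in>I. f i x) = (\<Sum>i\<in>I. LINT x:A|M. f i x)"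
  using assms unfolding set_integrable_def set_lebesgue_integral_def
  by (simp_all add: scaleR_sum_right)

locale lattice_sampling =
  fixes B :: "real^'n^'n" and w :: real
  assumes invertible: "invertible B" and w_pos: "w > 0"

text \<open>Both lattices carry the Voronoi geometry: \<open>L\<close> serves the average over time,
  \<open>A\<close> the aliasing of frequencies.\<close>

sublocale lattice_sampling \<subseteq> L: point_lattice "lattice_of B"
  using invertible by (rule point_lattice_lattice_of)

sublocale lattice_sampling \<subseteq> A: point_lattice "scaled_dual (lattice_of B)"
  using dual_basis[OF invertible] point_lattice_lattice_of by metis

context lattice_sampling
begin

text \<open>The samples cannot distinguish the frequencies of one orbit, so the character is
  replaced by its mean over the orbit points in the band. Where an orbit misses the band, the
  quotient is 0 by the convention for division by zero.\<close>

definition alias_mean :: "real^'n \<Rightarrow> real^'n \<Rightarrow> complex" where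
  "alias_mean t x = A.periodize w (\<lambda>y. cis (y \<bullet> t)) x / of_nat (A.hit_count w x)"

lemma borel_character [measurable]: "(\<lambda>x::real^'n. cis (x \<bullet> t)) \<in> borel_measurable borel"
  by (intro borel_measurable_continuous_onI continuous_intros)

lemma borel_alias_mean [measurable]: "alias_mean t \<in> borel_measurable borel"
  unfolding alias_mean_def by measurable

lemma norm_alias_mean: "norm (alias_mean t x) \<le> 1"
proof -
  have "norm (A.periodize w (\<lambda>y. cis (y \<bullet> t)) x) \<le> real (A.hit_count w x)"
    unfolding A.periodize_def A.hit_count_def by (rule order.trans[OF norm_sum]) simp
  then show ?thesis by (simp add: alias_mean_def norm_divide divide_le_eq)
qed

lemma alias_mean_periodic:
  "l \<in> scaled_dual (lattice_of B) \<Longrightarrow> alias_mean t (x + l) = alias_mean t x"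
  by (simp add: alias_mean_def A.periodize_periodic A.hit_count_periodic)

text \<open>The squared distance from a unimodular character to its projection
  \<open>alias_mean t\<close>, already simplified by Pythagoras.\<close>

definition spectral_error :: "real^'n \<Rightarrow> real" where
  "spectral_error t = (LINT x:cball 0 w|lborel. 1 - (cmod (alias_mean t x))\<^sup>2)"

lemma borel_trig_polynomial: "trig_polynomial (lattice_of B) p \<Longrightarrow> p \<in> borel_measurable borel"
  by (intro borel_measurable_continuous_onI continuous_trig_polynomial)

lemma cmod_diff_square: "(cmod (a - b))\<^sup>2 = (cmod a)\<^sup>2 + (cmod b)\<^sup>2 - 2 * Re (a * cnj b)"
  unfolding cmod_power2 by (simp add: power2_eq_square algebra_simps)

text \<open>The conjugate of \<open>p\<close> is periodic, so \<open>integral_periodize\<close>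
  makes the character minus its orbit mean orthogonal to \<open>p\<close>.\<close>

lemma spectral_pythagoras:
  assumes p: "trig_polynomial (lattice_of B) p"
  shows "(LINT x:cball 0 w|lborel. (cmod (cis (x \<bullet> t) - p x))\<^sup>2)
       = spectral_error t + (LINT x:cball 0 w|lborel. (cmod (alias_mean t x - p x))\<^sup>2)"
proof -
  let ?g = "alias_mean t" and ?D = "cball (0::real^'n) w"
  note [measurable] = borel_trig_polynomial[OF p]
  have [measurable]: "(\<lambda>x. cnj (p x)) \<in> borel_measurable borel"
    by (intro borel_measurable_continuous_onI continuous_intros continuous_trig_polynomial[OF p])
  obtain M where M: "\<And>x. norm (p x) \<le> M" using trig_polynomial_bounded[OF p] by blast
  have M0: "M \<ge> 0" using M[of 0] norm_ge_zero order_trans by blast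
  note int = set_integrable_bounded_borel[OF _ bounded_cball, of 0 w]
  have i1: "set_integrable lborel ?D (\<lambda>x. 1 - (cmod (?g x))\<^sup>2)"
    by (rule int[where M = 1]) (auto simp: abs_le_iff abs_square_le_1 norm_alias_mean intro: order.trans[of _ 0])
  have i2: "set_integrable lborel ?D (\<lambda>x. (cmod (?g x - p x))\<^sup>2)"
  proof (rule int[where M = "(1 + M)\<^sup>2"])
    fix x
    have "cmod (?g x - p x) \<le> 1 + M"
      using norm_triangle_ineq4[of "?g x" "p x"] norm_alias_mean[of t x] M[of x] by linarith
    then show "norm ((cmod (?g x - p x))\<^sup>2) \<le> (1 + M)\<^sup>2" by (simp add: power_mono)
  qed auto
  have i3: "set_integrable lborel ?D (\<lambda>x. cis (x \<bullet> t) * cnj (p x))"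
    by (rule int[where M = M]) (auto simp: norm_mult M)
  have i4: "set_integrable lborel ?D (\<lambda>x. ?g x * cnj (p x))"
    by (rule int[where M = "1 * M"]) (use mult_mono[OF norm_alias_mean M] in \<open>auto simp: norm_mult\<close>)
  have "(LINT x:?D|lborel. cis (x \<bullet> t) * cnj (p x)) = (LINT x:?D|lborel. ?g x * cnj (p x))"
    unfolding alias_mean_def
    by (rule A.integral_periodize[where H = 1 and Q = M])
       (auto simp: M trig_polynomial_periodic[OF p])
  then have orth: "(LINT x:?D|lborel. (cis (x \<bullet> t) - ?g x) * cnj (p x)) = 0"
    using i3 i4 by (simp add: left_diff_distrib set_integral_diff)
  have i5: "set_integrable lborel ?D (\<lambda>x. (cis (x \<bullet> t) - ?g x) * cnj (p x))"
    using i3 i4 by (simp add: left_diff_distrib set_integral_diff)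
  define r where "r x = Re ((cis (x \<bullet> t) - ?g x) * cnj (p x))" for x
  have orthRe: "(LINT x:?D|lborel. r x) = 0" and ir: "set_integrable lborel ?D r"
    using arg_cong[OF orth, of Re] i5 integral_Re integrable_Re
    unfolding set_lebesgue_integral_def set_integrable_def r_def by fastforce+
  \<comment> \<open>Both sides expand to 1 plus the squared modulus of \<open>p x\<close> minus a
    cross term; \<open>2 * r x\<close> is the difference of the cross terms.\<close>
  have "(cmod (cis (x \<bullet> t) - p x))\<^sup>2 = (1 - (cmod (?g x))\<^sup>2) + (cmod (?g x - p x))\<^sup>2 - 2 * r x" for x
    unfolding cmod_diff_square r_def by (simp add: algebra_simps)
  then have "(LINT x:?D|lborel. (cmod (cis (x \<bullet> t) - p x))\<^sup>2)
      = (LINT x:?D|lborel. (1 - (cmod (?g x))\<^sup>2) + (cmod (?g x - p x))\<^sup>2 - 2 * r x)" by simp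
  also have "\<dots> = spectral_error t + (LINT x:?D|lborel. (cmod (?g x - p x))\<^sup>2) - 2 * (LINT x:?D|lborel. r x)"
    unfolding spectral_error_def using i1 i2 ir by (simp add: set_integral_diff set_integral_add)
  finally show ?thesis using orthRe by simp
qed

text \<open>Expanding the squared orbit mean gives characters of t at differences l - m of dual
  vectors. Integration over the sampling cell retains l = m alone, and the diagonal sums to the
  inverse hit count.\<close>

lemma integral_spectral_error:
  "(LINT t:voronoi (lattice_of B)|lborel. spectral_error t)
    = measure lborel (voronoi (lattice_of B)) *
      (measure lborel (cball (0::real^'n) w) - measure lborel (cball 0 w \<inter> voronoi (scaled_dual (lattice_of B))))"
proof -
  let ?D = "cball (0::real^'n) w" and ?V = "voronoi (lattice_of B)" and ?\<Lambda> = "scaled_dual (lattice_of B)"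
  define F where "F = ?\<Lambda> \<inter> cball 0 (w + w)"
  have F: "finite F" unfolding F_def by (rule A.finite_Int_cball)
  define N where "N x = complex_of_nat (A.hit_count w x)" for x
  have N [measurable]: "N \<in> borel_measurable borel" unfolding N_def by measurable
  define u where "u l m x = indicator ?D (x + l) * indicator ?D (x + m) / (N x)\<^sup>2" for l m x
  have u [measurable]: "u l m \<in> borel_measurable borel" for l m
  proof -
    have [measurable]: "?D \<in> sets borel" by simp
    show ?thesis unfolding u_def by measurable
  qed
  define G where "G l m = (LINT x:?D|lborel. u l m x)" for l m
  have nN: "norm (1 / N x) \<le> 1" for x
    by (cases "A.hit_count w x = 0") (auto simp: norm_divide N_def)
  have un: "norm (u l m x) \<le> 1" for l m x
  proof -
    have "norm (u l m x) \<le> norm (1 / N x) * norm (1 / N x)"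
      by (auto simp: u_def norm_divide norm_mult power2_eq_square indicator_def)
    also have "\<dots> \<le> 1 * 1" using nN by (intro mult_mono) auto
    finally show ?thesis by simp
  qed
  have iu: "set_integrable lborel ?D (\<lambda>x. u l m x * c)" for l m c
    by (rule set_integrable_bounded_borel[where M = "1 * norm c"])
       (use mult_right_mono[OF un norm_ge_zero] in \<open>auto simp: norm_mult\<close>)
  have iD: "set_integrable lborel ?D (\<lambda>x. 1 :: complex)"
    by (rule set_integrable_bounded_borel[where M = 1]) auto
  have pt: "complex_of_real (1 - (cmod (alias_mean t x))\<^sup>2)
      = 1 - (\<Sum>l\<in>F. \<Sum>m\<in>F. u l m x * cis ((l - m) \<bullet> t))" if "norm x \<le> w" for t x
  proof -
    have "alias_mean t x = (\<Sum>l\<in>F. indicator ?D (x + l) / N x * cis ((x + l) \<bullet> t))"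
      unfolding alias_mean_def A.periodize_eq_sum[OF that] F_def N_def by (simp add: sum_divide_distrib)
    then have "alias_mean t x * cnj (alias_mean t x)
      = (\<Sum>l\<in>F. \<Sum>m\<in>F. (indicator ?D (x + l) / N x * cis ((x + l) \<bullet> t)) *
           cnj (indicator ?D (x + m) / N x * cis ((x + m) \<bullet> t)))"
      by (simp only: cnj_sum sum_product)
    also have "\<dots> = (\<Sum>l\<in>F. \<Sum>m\<in>F. u l m x * cis ((l - m) \<bullet> t))"
    proof (intro sum.cong refl)
      fix l m
      have "cis ((l - m) \<bullet> t) = cis ((x + l) \<bullet> t) * cnj (cis ((x + m) \<bullet> t))"
        by (simp add: cis_cnj cis_mult inner_add_left inner_diff_left)
      then show "(indicator ?D (x + l) / N x * cis ((x + l) \<bullet> t)) *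
           cnj (indicator ?D (x + m) / N x * cis ((x + m) \<bullet> t)) = u l m x * cis ((l - m) \<bullet> t)"
        by (simp add: u_def N_def power2_eq_square indicator_def)
    qed
    finally show ?thesis by (simp only: of_real_diff of_real_1 complex_norm_square)
  qed
  have E: "complex_of_real (spectral_error t)
      = of_real (measure lborel ?D) - (\<Sum>l\<in>F. \<Sum>m\<in>F. G l m * cis ((l - m) \<bullet> t))" for t
  proof -
    have "complex_of_real (spectral_error t) = (LINT x:?D|lborel. complex_of_real (1 - (cmod (alias_mean t x))\<^sup>2))"
      unfolding spectral_error_def by (rule set_integral_complex_of_real[symmetric])
    also have "\<dots> = (LINT x:?D|lborel. 1 - (\<Sum>l\<in>F. \<Sum>m\<in>F. u l m x * cis ((l - m) \<bullet> t)))"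
      using pt by (intro set_lebesgue_integral_cong) auto
    also have "\<dots> = (LINT x:?D|lborel. 1) - (\<Sum>l\<in>F. \<Sum>m\<in>F. G l m * cis ((l - m) \<bullet> t))"
      unfolding G_def using F iu iD
      by (simp add: set_integral_diff set_integrable_sum set_integral_sum set_integral_mult_left)
    also have "(LINT x:?D|lborel. 1) = complex_of_real (measure lborel ?D)"
      unfolding set_lebesgue_integral_def
      by (subst integral_scaleR_left)
         (auto intro!: integrable_real_indicator emeasure_bounded_finite simp: of_real_def)
    finally show ?thesis .
  qed
  have iV: "set_integrable lborel ?V (\<lambda>t. c * cis (a \<bullet> t))" for a c
  proof -
    obtain R where "?V \<subseteq> cball 0 R" using L.bounded_voronoi by auto
    moreover have "(\<lambda>t. c * cis (a \<bullet> t)) \<in> borel_measurable borel"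
      by (intro borel_measurable_continuous_onI continuous_intros)
    ultimately show ?thesis
      by (intro set_integrable_bounded_borel[where M = "norm c"])
         (auto simp: norm_mult intro: bounded_subset[OF bounded_cball])
  qed
  have "complex_of_real (LINT t:?V|lborel. spectral_error t) = (LINT t:?V|lborel. complex_of_real (spectral_error t))"
    by (rule set_integral_complex_of_real[symmetric])
  \<comment> \<open>The constant is written with the trivial character, so that it is covered by the
    same integrability fact as the other terms.\<close>
  also have "\<dots> = (LINT t:?V|lborel. of_real (measure lborel ?D) * cis (0 \<bullet> t) - (\<Sum>l\<in>F. \<Sum>m\<in>F. G l m * cis ((l - m) \<bullet> t)))"
    unfolding E by simp
  also have "\<dots> = of_real (measure lborel ?D) * (LINT t:?V|lborel. cis (0 \<bullet> t))
      - (\<Sum>l\<in>F. \<Sum>m\<in>F. G l m * (LINT t:?V|lborel. cis ((l - m) \<bullet> t)))"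
    using F iV
    by (simp only: set_integral_diff set_integrable_sum set_integral_sum set_integral_mult_right finite)
  also have "(\<Sum>l\<in>F. \<Sum>m\<in>F. G l m * (LINT t:?V|lborel. cis ((l - m) \<bullet> t)))
      = (\<Sum>l\<in>F. G l l * of_real (measure lborel ?V))"
  proof (rule sum.cong[OF refl])
    fix l assume l: "l \<in> F"
    have "(\<Sum>m\<in>F. G l m * (LINT t:?V|lborel. cis ((l - m) \<bullet> t)))
        = (\<Sum>m\<in>F. if m = l then G l l * of_real (measure lborel ?V) else 0)"
      using l A.diff_mem by (intro sum.cong refl) (auto simp: integral_voronoi_character[OF invertible] F_def)
    then show "(\<Sum>m\<in>F. G l m * (LINT t:?V|lborel. cis ((l - m) \<bullet> t))) = G l l * of_real (measure lborel ?V)"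
      using F l by simp
  qed
  \<comment> \<open>With N the hit count of x, exactly N of the diagonal terms equal 1 / N^2 and the
    rest vanish, so they add up to 1 / N.\<close>
  also have "\<dots> = (LINT x:?D|lborel. \<Sum>l\<in>F. u l l x) * of_real (measure lborel ?V)"
    unfolding G_def using iu[of _ _ 1] F by (simp add: set_integral_sum sum_distrib_right)
  also have "(LINT x:?D|lborel. \<Sum>l\<in>F. u l l x) = (LINT x:?D|lborel. 1 / of_nat (A.hit_count w x))"
  proof (rule set_lebesgue_integral_cong)
    show "\<forall>x. x \<in> ?D \<longrightarrow> (\<Sum>l\<in>F. u l l x) = 1 / of_nat (A.hit_count w x)"
    proof (intro allI impI)
      fix x assume "x \<in> ?D"
      then have x: "norm x \<le> w" by simp
      have "(\<Sum>l\<in>F. u l l x) = (\<Sum>l\<in>F. indicator ?D (x + l)) / (N x)\<^sup>2"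
        unfolding u_def sum_divide_distrib by (intro sum.cong) (auto simp: indicator_def)
      also have "(\<Sum>l\<in>F. indicator ?D (x + l)) = N x"
        unfolding N_def A.of_nat_hit_count A.periodize_eq_sum[OF x] F_def by simp
      finally show "(\<Sum>l\<in>F. u l l x) = 1 / of_nat (A.hit_count w x)"
        using A.hit_count_pos[OF x] by (simp add: N_def power2_eq_square)
    qed
  qed simp
  also note A.integral_inverse_hit_count
  also have "(LINT t:?V|lborel. cis (0 \<bullet> t)) = of_real (measure lborel ?V)"
    using integral_voronoi_character[OF invertible A.zero_mem] by simp
  finally have "complex_of_real (LINT t:?V|lborel. spectral_error t) = of_real (measure lborel ?V *
      (measure lborel ?D - measure lborel (?D \<inter> voronoi ?\<Lambda>)))"
    by (simp add: algebra_simps)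
  then show ?thesis by (simp only: of_real_eq_iff)
qed

end

section \<open>The spectral isometry and orthogonal projection\<close>

lemma square_integrable_rv_mult:
  assumes "Y \<in> square_integrable_rv M" "Z \<in> square_integrable_rv M"
  shows "integrable M (\<lambda>\<omega>. Y \<omega> * cnj (Z \<omega>))"
proof -
  have [measurable]: "Y \<in> borel_measurable M" "Z \<in> borel_measurable M"
    and int: "integrable M (\<lambda>\<omega>. (cmod (Y \<omega>))\<^sup>2)" "integrable M (\<lambda>\<omega>. (cmod (Z \<omega>))\<^sup>2)"
    using assms by (auto simp: square_integrable_rv_def)
  have [measurable]: "(\<lambda>\<omega>. cnj (Z \<omega>)) \<in> borel_measurable M"
    by (rule measurable_compose[OF \<open>Z \<in> borel_measurable M\<close>])
       (intro borel_measurable_continuous_onI continuous_intros)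
  show ?thesis
  proof (rule Bochner_Integration.integrable_bound)
    show "integrable M (\<lambda>\<omega>. (cmod (Y \<omega>))\<^sup>2 + (cmod (Z \<omega>))\<^sup>2)" using int by simp
    have "cmod (Y \<omega>) * cmod (Z \<omega>) \<le> (cmod (Y \<omega>))\<^sup>2 + (cmod (Z \<omega>))\<^sup>2" for \<omega>
      using sum_squares_bound[of "cmod (Y \<omega>)" "cmod (Z \<omega>)"]
        mult_nonneg_nonneg[of "cmod (Y \<omega>)" "cmod (Z \<omega>)"] norm_ge_zero[of "Y \<omega>"] norm_ge_zero[of "Z \<omega>"]
      by linarith
    then show "AE \<omega> in M. norm (Y \<omega> * cnj (Z \<omega>)) \<le> norm ((cmod (Y \<omega>))\<^sup>2 + (cmod (Z \<omega>))\<^sup>2)"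
      by (simp add: norm_mult)
  qed measurable
qed

lemma square_integrable_rv_sum:
  assumes "finite F" "\<And>b. b \<in> F \<Longrightarrow> Y b \<in> square_integrable_rv M"
  shows "(\<lambda>\<omega>. \<Sum>b\<in>F. c b * Y b \<omega>) \<in> square_integrable_rv M"
proof -
  have [measurable]: "\<And>b. b \<in> F \<Longrightarrow> Y b \<in> borel_measurable M"
    using assms by (auto simp: square_integrable_rv_def)
  have "integrable M (\<lambda>\<omega>. \<Sum>a\<in>F. \<Sum>b\<in>F. (c a * cnj (c b)) * (Y a \<omega> * cnj (Y b \<omega>)))"
    by (intro Bochner_Integration.integrable_sum integrable_mult_right square_integrable_rv_mult assms)
  also have "(\<lambda>\<omega>. \<Sum>a\<in>F. \<Sum>b\<in>F. (c a * cnj (c b)) * (Y a \<omega> * cnj (Y b \<omega>)))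
      = (\<lambda>\<omega>. of_real ((cmod (\<Sum>b\<in>F. c b * Y b \<omega>))\<^sup>2))"
    by (simp only: complex_norm_square cnj_sum sum_product complex_cnj_mult mult_ac)
  finally have "integrable M (\<lambda>\<omega>. complex_of_real ((cmod (\<Sum>b\<in>F. c b * Y b \<omega>))\<^sup>2))" .
  then have "integrable M (\<lambda>\<omega>. (cmod (\<Sum>b\<in>F. c b * Y b \<omega>))\<^sup>2)"
    by (simp only: complex_of_real_integrable_eq)
  then show ?thesis by (auto simp: square_integrable_rv_def)
qed

lemma square_integrable_rv_diff:
  assumes "Y \<in> square_integrable_rv M" "Z \<in> square_integrable_rv M"
  shows "(\<lambda>\<omega>. Y \<omega> - Z \<omega>) \<in> square_integrable_rv M"
  using square_integrable_rv_sum[of UNIV "\<lambda>b. if b then Y else Z" M "\<lambda>b. if b then 1 else -1"] assms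
  by (simp add: UNIV_bool)

text \<open>The cross term is the integral of Y - P against the conjugate of P - Z, which vanishes
  by the two orthogonality relations.\<close>

lemma integral_pythagoras_rv:
  assumes "Y \<in> square_integrable_rv M" "P \<in> square_integrable_rv M" "Z \<in> square_integrable_rv M"
    and orth: "(\<integral>\<omega>. (Y \<omega> - P \<omega>) * cnj (P \<omega>) \<partial>M) = 0" "(\<integral>\<omega>. (Y \<omega> - P \<omega>) * cnj (Z \<omega>) \<partial>M) = 0"
  shows "(\<integral>\<omega>. (cmod (Y \<omega> - Z \<omega>))\<^sup>2 \<partial>M)
       = (\<integral>\<omega>. (cmod (Y \<omega> - P \<omega>))\<^sup>2 \<partial>M) + (\<integral>\<omega>. (cmod (P \<omega> - Z \<omega>))\<^sup>2 \<partial>M)"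
proof -
  have YP: "(\<lambda>\<omega>. Y \<omega> - P \<omega>) \<in> square_integrable_rv M" and PZ: "(\<lambda>\<omega>. P \<omega> - Z \<omega>) \<in> square_integrable_rv M"
    using assms by (auto intro: square_integrable_rv_diff)
  define r where "r \<omega> = (Y \<omega> - P \<omega>) * cnj (P \<omega>) - (Y \<omega> - P \<omega>) * cnj (Z \<omega>)" for \<omega>
  have ir: "integrable M r"
    unfolding r_def using YP assms by (intro Bochner_Integration.integrable_diff square_integrable_rv_mult)
  have "(\<integral>\<omega>. r \<omega> \<partial>M) = 0"
    unfolding r_def using YP assms by (subst Bochner_Integration.integral_diff) (auto intro: square_integrable_rv_mult)
  then have r0: "(\<integral>\<omega>. Re (r \<omega>) \<partial>M) = 0"
    using integral_Re[OF ir] by simp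
  have "(cmod (Y \<omega> - Z \<omega>))\<^sup>2 = (cmod (Y \<omega> - P \<omega>))\<^sup>2 + (cmod (P \<omega> - Z \<omega>))\<^sup>2 + 2 * Re (r \<omega>)" for \<omega>
    unfolding cmod_power2 r_def by (simp add: power2_eq_square algebra_simps)
  then have "(\<integral>\<omega>. (cmod (Y \<omega> - Z \<omega>))\<^sup>2 \<partial>M)
      = (\<integral>\<omega>. (cmod (Y \<omega> - P \<omega>))\<^sup>2 + (cmod (P \<omega> - Z \<omega>))\<^sup>2 + 2 * Re (r \<omega>) \<partial>M)" by simp
  also have "\<dots> = (\<integral>\<omega>. (cmod (Y \<omega> - P \<omega>))\<^sup>2 \<partial>M) + (\<integral>\<omega>. (cmod (P \<omega> - Z \<omega>))\<^sup>2 \<partial>M)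
      + 2 * (\<integral>\<omega>. Re (r \<omega>) \<partial>M)"
    using YP PZ integrable_Re[OF ir] by (simp add: square_integrable_rv_def)
  finally show ?thesis using r0 by simp
qed

lemma sample_span_subset_closed:
  assumes "\<And>t. X t \<in> square_integrable_rv M" "Z \<in> sample_span X L"
  shows "Z \<in> closed_sample_span M X L"
proof -
  have "Z \<in> square_integrable_rv M"
    using assms unfolding sample_span_def by (auto intro!: square_integrable_rv_sum)
  then show ?thesis
    using assms unfolding closed_sample_span_def by (auto intro!: bexI[of _ Z])
qed

text \<open>Both sides are Hermitian forms in the coefficients, and the covariance formula says that
  their Gram matrices agree up to the constant. The times in \<open>F\<close> are arbitrary, so the
  time to be interpolated may be among them.\<close>

lemma spectral_isometry:
  fixes X :: "real^'n \<Rightarrow> 'w \<Rightarrow> complex"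
  assumes X: "stationary_process_with_psd M X (isotropic_psd w S0)" and F: "finite F"
  shows "(\<integral>\<omega>. (cmod (\<Sum>b\<in>F. c b * X b \<omega>))\<^sup>2 \<partial>M)
       = S0 / (2 * pi) ^ CARD('n) * (LINT x:cball 0 w|lborel. (cmod (\<Sum>b\<in>F. c b * cis (x \<bullet> b)))\<^sup>2)"
proof -
  define C where "C = complex_of_real (S0 / (2 * pi) ^ CARD('n))"
  have sq: "X t \<in> square_integrable_rv M" for t
    using X by (simp add: stationary_process_with_psd_def)
  have cov: "(\<integral>\<omega>. X a \<omega> * cnj (X b \<omega>) \<partial>M)
      = C * (LINT x:cball 0 w|lborel. cis (x \<bullet> a) * cnj (cis (x \<bullet> b)))" for a b
  proof -
    have ch: "exp (\<i> * of_real (x \<bullet> (a - b))) = cis (x \<bullet> a) * cnj (cis (x \<bullet> b))" for x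
      by (simp only: cis_conv_exp[symmetric] cis_cnj cis_mult inner_diff_right) simp
    \<comment> \<open>The covariance formula is used with base time b and lag a - b.\<close>
    have "(\<integral>\<omega>. X (b + (a - b)) \<omega> * cnj (X b \<omega>) \<partial>M) =
        1 / of_real ((2 * pi) ^ CARD('n)) *
        (\<integral>x. of_real (isotropic_psd w S0 x) * exp (\<i> * of_real (x \<bullet> (a - b))) \<partial>lborel)"
      using X unfolding stationary_process_with_psd_def by blast
    moreover have "(\<integral>x. of_real (isotropic_psd w S0 x) * exp (\<i> * of_real (x \<bullet> (a - b))) \<partial>lborel)
        = (LINT x:cball 0 w|lborel. of_real S0 * (cis (x \<bullet> a) * cnj (cis (x \<bullet> b))))"
      unfolding set_lebesgue_integral_def ch
      by (intro Bochner_Integration.integral_cong refl) (auto simp: isotropic_psd_def indicator_def)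
    ultimately show ?thesis by (simp add: C_def)
  qed
  have int: "set_integrable lborel (cball 0 w) (\<lambda>x. d * (cis (x \<bullet> a) * cnj (cis (x \<bullet> b))))" for a b :: "real^'n" and d
  proof (rule set_integrable_bounded_borel[where M = "norm d"])
    show "(\<lambda>x. d * (cis (x \<bullet> a) * cnj (cis (x \<bullet> b)))) \<in> borel_measurable borel"
      by (intro borel_measurable_continuous_onI continuous_intros)
  qed (auto simp: norm_mult)
  have expand: "complex_of_real ((cmod (\<Sum>b\<in>F. c b * y b))\<^sup>2)
      = (\<Sum>a\<in>F. \<Sum>b\<in>F. (c a * cnj (c b)) * (y a * cnj (y b)))" for y
    by (simp only: complex_norm_square cnj_sum sum_product complex_cnj_mult mult_ac)
  have "complex_of_real (\<integral>\<omega>. (cmod (\<Sum>b\<in>F. c b * X b \<omega>))\<^sup>2 \<partial>M)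
      = (\<integral>\<omega>. (\<Sum>a\<in>F. \<Sum>b\<in>F. (c a * cnj (c b)) * (X a \<omega> * cnj (X b \<omega>))) \<partial>M)"
    unfolding expand[symmetric] by (rule integral_complex_of_real[symmetric])
  also have "\<dots> = (\<Sum>a\<in>F. \<Sum>b\<in>F. (c a * cnj (c b)) * (\<integral>\<omega>. X a \<omega> * cnj (X b \<omega>) \<partial>M))"
    using sq by (simp add: square_integrable_rv_mult)
  also have "\<dots> = C * (\<Sum>a\<in>F. \<Sum>b\<in>F. LINT x:cball 0 w|lborel. (c a * cnj (c b)) * (cis (x \<bullet> a) * cnj (cis (x \<bullet> b))))"
    by (simp add: cov sum_distrib_left mult_ac)
  also have "\<dots> = C * (LINT x:cball 0 w|lborel. \<Sum>a\<in>F. \<Sum>b\<in>F. (c a * cnj (c b)) * (cis (x \<bullet> a) * cnj (cis (x \<bullet> b))))"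
    using int by (simp only: set_integral_sum set_integrable_sum)
  also have "\<dots> = of_real (S0 / (2 * pi) ^ CARD('n) * (LINT x:cball 0 w|lborel. (cmod (\<Sum>b\<in>F. c b * cis (x \<bullet> b)))\<^sup>2))"
    unfolding expand[symmetric] set_integral_complex_of_real C_def by simp
  finally show ?thesis by (simp only: of_real_eq_iff)
qed

section \<open>Transfer of the projection error to the spectral domain\<close>

context lattice_sampling
begin

lemma sample_error_eq:
  fixes X :: "real^'n \<Rightarrow> 'w \<Rightarrow> complex"
  assumes X: "stationary_process_with_psd M X (isotropic_psd w S0)"
    and F: "finite F" "F \<subseteq> lattice_of B"
  shows "(\<integral>\<omega>. (cmod (X t \<omega> - (\<Sum>b\<in>F. c b * X b \<omega>)))\<^sup>2 \<partial>M)
       = S0 / (2 * pi) ^ CARD('n) * (spectral_error t +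
           (LINT x:cball 0 w|lborel. (cmod (alias_mean t x - (\<Sum>b\<in>F. c b * cis (x \<bullet> b))))\<^sup>2))"
proof -
  \<comment> \<open>The coefficient is a difference of two cases because t may itself be one of the
    sampling points in \<open>F\<close>.\<close>
  define e where "e b = (if b = t then 1 else 0) - (if b \<in> F then c b else 0)" for b
  have e: "(\<Sum>b\<in>insert t F. e b * y b) = y t - (\<Sum>b\<in>F. c b * y b)" for y
  proof -
    have "(\<Sum>b\<in>insert t F. (if b = t then 1 else 0) * y b) = (\<Sum>b\<in>insert t F. if b = t then y t else 0)"
      by (intro sum.cong) auto
    also have "\<dots> = y t" using F(1) by (subst sum.delta) auto
    finally have 1: "(\<Sum>b\<in>insert t F. (if b = t then 1 else 0) * y b) = y t" .
    have 2: "(\<Sum>b\<in>insert t F. (if b \<in> F then c b else 0) * y b) = (\<Sum>b\<in>F. c b * y b)"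
      using F by (intro sum.mono_neutral_cong_right) auto
    show ?thesis unfolding e_def left_diff_distrib sum_subtractf 1 2 ..
  qed
  have "trig_polynomial (lattice_of B) (\<lambda>x. \<Sum>b\<in>F. c b * cis (x \<bullet> b))"
    using F unfolding trig_polynomial_def by blast
  then show ?thesis
    using spectral_isometry[OF X, of "insert t F" e] F(1)
    unfolding e by (simp add: spectral_pythagoras)
qed

text \<open>Each inequality is shown up to \<delta> with finite combinations of samples. For the
  upper bound, a trigonometric polynomial close to \<open>alias_mean t\<close> supplies a
  competitor; for the lower bound, a combination of samples close to \<open>Xhat t\<close> has error
  at least the spectral one.\<close>

theorem interpolation_error:
  fixes X Xhat :: "real^'n \<Rightarrow> 'w \<Rightarrow> complex"
  assumes S0: "S0 > 0" and X: "stationary_process_with_psd M X (isotropic_psd w S0)"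
    and Xhat: "best_linear_interpolator M X (lattice_of B) Xhat"
  shows "(\<integral>\<omega>. (cmod (X t \<omega> - Xhat t \<omega>))\<^sup>2 \<partial>M) = S0 / (2 * pi) ^ CARD('n) * spectral_error t"
proof -
  define C where "C = S0 / (2 * pi) ^ CARD('n)"
  have C: "C > 0" using S0 by (simp add: C_def)
  have sq: "X t \<in> square_integrable_rv M" for t
    using X by (simp add: stationary_process_with_psd_def)
  have hat: "Xhat t \<in> closed_sample_span M X (lattice_of B)"
    and orth: "\<And>Y. Y \<in> closed_sample_span M X (lattice_of B) \<Longrightarrow>
      (\<integral>\<omega>. (X t \<omega> - Xhat t \<omega>) * cnj (Y \<omega>) \<partial>M) = 0"
    using Xhat unfolding best_linear_interpolator_def by auto
  have pyth: "(\<integral>\<omega>. (cmod (X t \<omega> - Z \<omega>))\<^sup>2 \<partial>M)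
       = (\<integral>\<omega>. (cmod (X t \<omega> - Xhat t \<omega>))\<^sup>2 \<partial>M) + (\<integral>\<omega>. (cmod (Xhat t \<omega> - Z \<omega>))\<^sup>2 \<partial>M)"
    if "Z \<in> sample_span X (lattice_of B)" for Z
    using sample_span_subset_closed[OF sq that] hat orth sq
    by (intro integral_pythagoras_rv) (auto simp: closed_sample_span_def)
  show ?thesis unfolding C_def[symmetric]
  proof (rule antisym; rule field_le_epsilon)
    fix \<delta> :: real assume d: "\<delta> > 0"
    obtain p where p: "trig_polynomial (lattice_of B) p"
      "(LINT x:cball 0 w|lborel. (cmod (alias_mean t x - p x))\<^sup>2) < \<delta> / C"
      using trig_polynomial_dense[where g = "alias_mean t" and \<epsilon> = "\<delta> / C" and w = w,
          OF invertible borel_alias_mean norm_alias_mean alias_mean_periodic divide_pos_pos[OF d C]] by blast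
    obtain F c where F: "finite F" "F \<subseteq> lattice_of B" "p = (\<lambda>x. \<Sum>b\<in>F. c b * cis (x \<bullet> b))"
      using p(1) unfolding trig_polynomial_def by auto
    have "(\<lambda>\<omega>. \<Sum>b\<in>F. c b * X b \<omega>) \<in> sample_span X (lattice_of B)"
      using F unfolding sample_span_def by auto
    from pyth[OF this] have "(\<integral>\<omega>. (cmod (X t \<omega> - Xhat t \<omega>))\<^sup>2 \<partial>M)
        \<le> (\<integral>\<omega>. (cmod (X t \<omega> - (\<Sum>b\<in>F. c b * X b \<omega>)))\<^sup>2 \<partial>M)"
      by simp
    also have "\<dots> = C * (spectral_error t + (LINT x:cball 0 w|lborel. (cmod (alias_mean t x - p x))\<^sup>2))"
      using sample_error_eq[OF X F(1,2)] F(3) by (simp add: C_def)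
    also have "\<dots> \<le> C * (spectral_error t + \<delta> / C)"
      using p(2) C by (intro mult_left_mono) auto
    also have "\<dots> = C * spectral_error t + \<delta>" using C by (simp add: field_simps)
    finally show "(\<integral>\<omega>. (cmod (X t \<omega> - Xhat t \<omega>))\<^sup>2 \<partial>M) \<le> C * spectral_error t + \<delta>" .
  next
    fix \<delta> :: real assume d: "\<delta> > 0"
    obtain Z where Z: "Z \<in> sample_span X (lattice_of B)" "(\<integral>\<omega>. (cmod (Xhat t \<omega> - Z \<omega>))\<^sup>2 \<partial>M) < \<delta>"
      using hat d unfolding closed_sample_span_def by auto
    obtain F c where F: "finite F" "F \<subseteq> lattice_of B" "Z = (\<lambda>\<omega>. \<Sum>b\<in>F. c b * X b \<omega>)"
      using Z(1) unfolding sample_span_def by auto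
    have "C * spectral_error t \<le> C * (spectral_error t
        + (LINT x:cball 0 w|lborel. (cmod (alias_mean t x - (\<Sum>b\<in>F. c b * cis (x \<bullet> b))))\<^sup>2))"
      using C unfolding set_lebesgue_integral_def by (intro mult_left_mono) auto
    also have "\<dots> = (\<integral>\<omega>. (cmod (X t \<omega> - Z \<omega>))\<^sup>2 \<partial>M)"
      using sample_error_eq[OF X F(1,2)] F(3) by (simp add: C_def)
    also have "\<dots> \<le> (\<integral>\<omega>. (cmod (X t \<omega> - Xhat t \<omega>))\<^sup>2 \<partial>M) + \<delta>"
      using pyth[OF Z(1)] Z(2) by simp
    finally show "C * spectral_error t \<le> (\<integral>\<omega>. (cmod (X t \<omega> - Xhat t \<omega>))\<^sup>2 \<partial>M) + \<delta>" .
  qed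
qed

end

section \<open>The lower bound and its equality cases\<close>

text \<open>The interior of S minus the closed T is open and null, hence empty. A convex set with
  nonempty interior lies in the closure of that interior, hence in T. This turns equalities of
  volumes into inclusions.\<close>

lemma convex_subset_of_measure_diff_eq_0:
  fixes S T :: "'a::euclidean_space set"
  assumes S: "convex S" "interior S \<noteq> {}" "bounded S" "S \<in> sets borel" and T: "closed T"
    and null: "measure lborel (S - T) = 0"
  shows "S \<subseteq> T"
proof -
  have ST: "S - T \<in> sets lborel" using S(4) T by auto
  have "emeasure lborel (S - T) < \<infinity>"
    using bounded_subset[OF S(3), of "S - T"] by (intro emeasure_bounded_finite) auto
  then have "emeasure lborel (S - T) = 0"
    using null by (auto simp: measure_def enn2real_eq_0_iff)
  then have "S - T \<in> null_sets lborel" using ST by auto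
  then have "negligible (S - T)"
    by (simp add: negligible_iff_null_sets null_sets_completionI)
  then have "negligible (interior S - T)"
    using interior_subset by (rule_tac negligible_subset) auto
  then have "interior S - T = {}"
    using open_not_negligible[of "interior S - T"] T by (auto simp: open_Diff)
  then have "closure (interior S) \<subseteq> T"
    using T by (intro closure_minimal) auto
  then show ?thesis
    using convex_closure_interior[OF S(1,2)] closure_subset by blast
qed

theorem theorem2:
  fixes B :: "real^'n^'n"
    and M :: "'w measure"
    and X Xhat :: "real^'n \<Rightarrow> 'w \<Rightarrow> complex"
    and \<omega>\<^sub>0 S\<^sub>0 r \<sigma>2 \<sigma>e2 \<sigma>lb2 :: real
  assumes "invertible B"
    and "\<omega>\<^sub>0 > 0" and "S\<^sub>0 > 0"
    and "stationary_process_with_psd M X (isotropic_psd \<omega>\<^sub>0 S\<^sub>0)"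
    and "best_linear_interpolator M X (lattice_of B) Xhat"
    and "r = sampling_rate (lattice_of B)"
    and "\<sigma>2 = rv_variance M (X 0)"
    and "\<sigma>e2 = avg_error_variance M X (lattice_of B) Xhat"
    and "\<sigma>lb2 = \<sigma>2 * max 0 (1 - Gamma (real CARD('n) / 2 + 1) / pi powr (real CARD('n) / 2)
                                * (r / \<omega>\<^sub>0) ^ CARD('n))"
  shows "\<sigma>e2 \<ge> \<sigma>lb2 \<and>
         (\<sigma>e2 = \<sigma>lb2 \<longleftrightarrow>
            \<omega>\<^sub>0 \<le> packing_radius (scaled_dual (lattice_of B)) \<or>
            \<omega>\<^sub>0 \<ge> covering_radius (scaled_dual (lattice_of B)))"
proof -
  interpret lattice_sampling B \<omega>\<^sub>0 using assms(1,2) by unfold_locales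
  let ?D = "cball (0::real^'n) \<omega>\<^sub>0" and ?V = "voronoi (lattice_of B)" and ?W = "voronoi (scaled_dual (lattice_of B))"
  define C where "C = S\<^sub>0 / (2 * pi) ^ CARD('n)"
  \<comment> \<open>In these volumes the error is \<open>C * (a - c)\<close> and the bound is
    \<open>C * max 0 (a - b)\<close>, so everything reduces to comparing c with a and b.\<close>
  define a b c where "a = measure lborel ?D" and "b = measure lborel ?W" and "c = measure lborel (?D \<inter> ?W)"
  have C: "C > 0" using assms(3) by (simp add: C_def)
  have a: "a = pi powr (real CARD('n) / 2) / Gamma (real CARD('n) / 2 + 1) * \<omega>\<^sub>0 ^ CARD('n)"
    using assms(2) content_cball[of \<omega>\<^sub>0 "0::real^'n"] by (simp add: a_def unit_ball_vol_def)
  have a_pos: "a > 0"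
    unfolding a using assms(2) by (intro mult_pos_pos divide_pos_pos Gamma_real_pos) (auto simp: add_pos_pos)
  have b_pos: "b > 0" unfolding b_def by (rule A.measure_voronoi_pos)

  have e: "\<sigma>e2 = C * (a - c)"
    using L.measure_voronoi_pos
    by (simp add: assms(8) avg_error_variance_def interpolation_error[OF assms(3-5)] integral_spectral_error
        a_def c_def C_def)

  have mean: "(\<integral>w. X 0 w \<partial>M) = 0"
    using assms(4) by (simp add: stationary_process_with_psd_def)
  \<comment> \<open>The variance is the isometry applied to the single time 0 with coefficient
    1.\<close>
  have "\<sigma>2 = (\<integral>w. (cmod (\<Sum>b\<in>{0}. 1 * X b w))\<^sup>2 \<partial>M)"
    by (simp add: assms(7) rv_variance_def mean)
  also have "\<dots> = C * (LINT x:?D|lborel. 1)"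
    unfolding C_def by (subst spectral_isometry[OF assms(4)]) simp_all
  also have "(LINT x:?D|lborel. 1) = a"
    by (simp add: a_def set_lebesgue_integral_def)
  finally have var: "\<sigma>2 = C * a" .

  have "r ^ CARD('n) = b"
    using b_pos by (simp add: assms(6) sampling_rate_def b_def[symmetric] powr_realpow[symmetric] powr_powr)
  then have "Gamma (real CARD('n) / 2 + 1) / pi powr (real CARD('n) / 2) * (r / \<omega>\<^sub>0) ^ CARD('n) = b / a"
    by (simp add: a power_divide)
  then have "\<sigma>lb2 = C * (a * max 0 (1 - b / a))"
    by (simp only: assms(9) var mult.assoc)
  also have "a * max 0 (1 - b / a) = max 0 (a - b)"
    using a_pos by (simp add: max_mult_distrib_left right_diff_distrib)
  finally have lb: "\<sigma>lb2 = C * max 0 (a - b)" .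

  have fin: "?D \<in> fmeasurable lborel" "?W \<in> fmeasurable lborel"
    using A.lmeasurable_voronoi by (auto intro!: fmeasurableI emeasure_bounded_finite)
  have DW: "measure lborel (?D - ?W) = a - c" and WD: "measure lborel (?W - ?D) = b - c"
    unfolding a_def b_def c_def
    using measurable_measure_Diff[OF fin(1), of "?D \<inter> ?W"] measurable_measure_Diff[OF fin(2), of "?D \<inter> ?W"] fin
    by (simp_all add: fmeasurableD sets.Int Diff_Int)
  have ca: "c \<le> a" "c \<le> b" using DW WD measure_nonneg by (metis diff_ge_0_iff_ge)+

  have "a = c \<longleftrightarrow> ?D \<subseteq> ?W"
  proof
    assume "a = c"
    then show "?D \<subseteq> ?W"
      using DW A.closed_voronoi assms(2) by (intro convex_subset_of_measure_diff_eq_0) auto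
  qed (simp add: a_def c_def Int_absorb2)
  moreover have "b = c \<longleftrightarrow> ?W \<subseteq> ?D"
  proof
    obtain \<epsilon> where "\<epsilon> > 0" "ball 0 \<epsilon> \<subseteq> ?W" using A.ball_subset_voronoi .
    then have "interior ?W \<noteq> {}" by (metis centre_in_ball empty_iff interior_maximal open_ball subsetD)
    moreover obtain R where "?W \<subseteq> cball 0 R" using A.bounded_voronoi .
    then have "bounded ?W" using bounded_subset bounded_cball by blast
    moreover assume "b = c"
    ultimately show "?W \<subseteq> ?D"
      using WD A.convex_voronoi by (intro convex_subset_of_measure_diff_eq_0) auto
  qed (simp add: b_def c_def Int_absorb1)
  \<comment> \<open>Since c is at most the smaller of a and b, equality of a - c with
    \<open>max 0 (a - b)\<close> forces c to be that minimum.\<close>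
  moreover have "\<sigma>e2 = \<sigma>lb2 \<longleftrightarrow> a = c \<or> b = c"
    using C ca unfolding e lb by (auto simp: max_def)
  moreover have "\<sigma>lb2 \<le> \<sigma>e2"
    using C ca unfolding e lb by (intro mult_left_mono) auto
  ultimately show ?thesis
    using A.cball_subset_voronoi_iff[OF assms(2)] A.voronoi_subset_cball_iff by blast
qed

end
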